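(* Let $(A,\cdot_A,[,]_A,\alpha_A,\beta_A)$ and $(B,\cdot_B,[,]_B,\alpha_B,\beta_B)$ be two regular transposed BiHom-Poisson algebras over $K$. Define two bilinear operations $\cdot$ and $[,]$ on $A\otimes B$ by $$(a\otimes b)\cdot(a'\otimes b')=a\cdot_A a'\otimes b\cdot_B b',$$ $$[a\otimes b,a'\otimes b']=[a,a']_A\otimes b\cdot_B b'+a\cdot_A a'\otimes[b,b']_B,$$ for all $a,a'\in A$, $b,b'\in B$. Then $(A\otimes B,\cdot,[,],\alpha_A\otimes\alpha_B,\beta_A\otimes\beta_B)$ is a transposed BiHom-Poisson algebra.
   Context: $K$ is a field of characteristic $0$; all vector spaces, tensor products and linear maps are over $K$. A BiHom-commutative algebra $(L,\cdot,\alpha,\beta)$ is a vector space $L$ with a bilinear product $\cdot$ and linear maps $\alpha,\beta:L\to L$ such that for all $x,y,z$: $\alpha\circ\beta=\beta\circ\alpha$, $\alpha(x\cdot y)=\alpha(x)\cdot\alpha(y)$, $\beta(x\cdot y)=\beta(x)\cdot\beta(y)$, $\alpha(x)\cdot(y\cdot z)=(x\cdot y)\cdot\beta(z)$, and $\beta(x)\cdot\alpha(y)=\beta(y)\cdot\alpha(x)$. A BiHom-Lie algebra $(L,[,],\alpha,\beta)$ is a vector space $L$ with a bilinear bracket and commuting linear maps $\alpha,\beta:L\to L$ such that for all $x,y,z$: $\alpha([x,y])=[\alpha(x),\alpha(y)]$, $\beta([x,y])=[\beta(x),\beta(y)]$, $[\beta(x),\alpha(y)]=-[\beta(y),\alpha(x)]$,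 and $[[\beta(x),\alpha(y)],\alpha^2(z)]+[[\beta(y),\alpha(z)],\alpha^2(x)]+[[\beta(z),\alpha(x)],\alpha^2(y)]=0$. A transposed BiHom-Poisson algebra is a 5-tuple $(L,\cdot,[,],\alpha,\beta)$ such that $(L,\cdot,\alpha,\beta)$ is a BiHom-commutative algebra, $(L,[,],\alpha,\beta)$ is a BiHom-Lie algebra, and for all $x,y,z$: $2\alpha\beta(x)\cdot[y,z]=[\beta(x)\cdot y,\beta(z)]+[\beta(y),\alpha(x)\cdot z]$. It is regular if $\alpha,\beta$ are invertible. *)

theory Defs
  imports "HOL-Algebra.Module" "HOL-Algebra.AbelCoset"
begin

section \<open>Linear and bilinear maps between modules\<close>

definition linear_map ::
  "('k, 'm) ring_scheme \<Rightarrow> ('k, 'a, 'ma) module_scheme \<Rightarrow> ('k, 'b, 'mb) module_scheme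
    \<Rightarrow> ('a \<Rightarrow> 'b) \<Rightarrow> bool"
  where "linear_map K V W f \<longleftrightarrow>
    f \<in> carrier V \<rightarrow> carrier W \<and>
    (\<forall>x\<in>carrier V. \<forall>y\<in>carrier V. f (x \<oplus>\<^bsub>V\<^esub> y) = f x \<oplus>\<^bsub>W\<^esub> f y) \<and>
    (\<forall>k\<in>carrier K. \<forall>x\<in>carrier V. f (k \<odot>\<^bsub>V\<^esub> x) = k \<odot>\<^bsub>W\<^esub> f x)"

definition bilinear_map ::
  "('k, 'm) ring_scheme \<Rightarrow> ('k, 'a, 'ma) module_scheme \<Rightarrow> ('k, 'b, 'mb) module_scheme
    \<Rightarrow> ('k, 'c, 'mc) module_scheme \<Rightarrow> ('a \<Rightarrow> 'b \<Rightarrow> 'c) \<Rightarrow> bool"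
  where "bilinear_map K V W U f \<longleftrightarrow>
    (\<forall>x\<in>carrier V. linear_map K W U (\<lambda>y. f x y)) \<and>
    (\<forall>y\<in>carrier W. linear_map K V U (\<lambda>x. f x y))"


section \<open>Transposed BiHom-Poisson algebras\<close>

locale bihom_algebra = K?: field K + V?: module K V
  for K :: "('k, 'm) ring_scheme" (structure)
    and V :: "('k, 'a, 'ma) module_scheme" (structure) +
  fixes prd :: "'a \<Rightarrow> 'a \<Rightarrow> 'a" and \<alpha> :: "'a \<Rightarrow> 'a" and \<beta> :: "'a \<Rightarrow> 'a"
  assumes prd_bilinear: "bilinear_map K V V V prd"
    and \<alpha>_linear: "linear_map K V V \<alpha>"
    and \<beta>_linear: "linear_map K V V \<beta>"
    and \<alpha>_\<beta>_commute: "x \<in> carrier V \<Longrightarrow> \<alpha> (\<beta> x) = \<beta> (\<alpha> x)"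
    and \<alpha>_prd: "\<lbrakk>x \<in> carrier V; y \<in> carrier V\<rbrakk> \<Longrightarrow> \<alpha> (prd x y) = prd (\<alpha> x) (\<alpha> y)"
    and \<beta>_prd: "\<lbrakk>x \<in> carrier V; y \<in> carrier V\<rbrakk> \<Longrightarrow> \<beta> (prd x y) = prd (\<beta> x) (\<beta> y)"

locale bihom_commutative_algebra = bihom_algebra K V dot \<alpha> \<beta>
  for K :: "('k, 'm) ring_scheme" (structure)
    and V :: "('k, 'a, 'ma) module_scheme" (structure)
    and dot :: "'a \<Rightarrow> 'a \<Rightarrow> 'a" and \<alpha> :: "'a \<Rightarrow> 'a" and \<beta> :: "'a \<Rightarrow> 'a" +
  assumes bihom_assoc: "\<lbrakk>x \<in> carrier V; y \<in> carrier V; z \<in> carrier V\<rbrakk> \<Longrightarrow>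
      dot (\<alpha> x) (dot y z) = dot (dot x y) (\<beta> z)"
    and bihom_comm: "\<lbrakk>x \<in> carrier V; y \<in> carrier V\<rbrakk> \<Longrightarrow>
      dot (\<beta> x) (\<alpha> y) = dot (\<beta> y) (\<alpha> x)"

locale bihom_lie_algebra = bihom_algebra K V brk \<alpha> \<beta>
  for K :: "('k, 'm) ring_scheme" (structure)
    and V :: "('k, 'a, 'ma) module_scheme" (structure)
    and brk :: "'a \<Rightarrow> 'a \<Rightarrow> 'a" and \<alpha> :: "'a \<Rightarrow> 'a" and \<beta> :: "'a \<Rightarrow> 'a" +
  assumes bihom_skew: "\<lbrakk>x \<in> carrier V; y \<in> carrier V\<rbrakk> \<Longrightarrow>
      brk (\<beta> x) (\<alpha> y) = \<ominus>\<^bsub>V\<^esub> brk (\<beta> y) (\<alpha> x)"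
    and bihom_jacobi: "\<lbrakk>x \<in> carrier V; y \<in> carrier V; z \<in> carrier V\<rbrakk> \<Longrightarrow>
      brk (brk (\<beta> x) (\<alpha> y)) (\<alpha> (\<alpha> z)) \<oplus>\<^bsub>V\<^esub>
      brk (brk (\<beta> y) (\<alpha> z)) (\<alpha> (\<alpha> x)) \<oplus>\<^bsub>V\<^esub>
      brk (brk (\<beta> z) (\<alpha> x)) (\<alpha> (\<alpha> y)) = \<zero>\<^bsub>V\<^esub>"

locale transposed_bihom_poisson_algebra =
  commutative: bihom_commutative_algebra K V dot \<alpha> \<beta> + lie: bihom_lie_algebra K V brk \<alpha> \<beta>
  for K :: "('k, 'm) ring_scheme" (structure)
    and V :: "('k, 'a, 'ma) module_scheme" (structure)
    and dot :: "'a \<Rightarrow> 'a \<Rightarrow> 'a" and brk :: "'a \<Rightarrow> 'a \<Rightarrow> 'a"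
    and \<alpha> :: "'a \<Rightarrow> 'a" and \<beta> :: "'a \<Rightarrow> 'a" +
  assumes transposed_leibniz: "\<lbrakk>x \<in> carrier V; y \<in> carrier V; z \<in> carrier V\<rbrakk> \<Longrightarrow>
      [(2::nat)] \<cdot>\<^bsub>V\<^esub> dot (\<alpha> (\<beta> x)) (brk y z) =
      brk (dot (\<beta> x) y) (\<beta> z) \<oplus>\<^bsub>V\<^esub> brk (\<beta> y) (dot (\<alpha> x) z)"

locale regular_transposed_bihom_poisson_algebra = transposed_bihom_poisson_algebra +
  assumes \<alpha>_bij: "bij_betw \<alpha> (carrier V) (carrier V)"
    and \<beta>_bij: "bij_betw \<beta> (carrier V) (carrier V)"


section \<open>The tensor product of two modules\<close>

text \<open>The tensor product is the free module on the pairs modulo the bilinearity relations.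
  A module record contains a multiplication and a unit, which play no role here.\<close>

definition free_module :: "('k, 'm) ring_scheme \<Rightarrow> 's set \<Rightarrow> ('k, 's \<Rightarrow> 'k) module"
  where "free_module K S =
    \<lparr>carrier = {f. (\<forall>s\<in>S. f s \<in> carrier K) \<and> (\<forall>s. s \<notin> S \<longrightarrow> f s = \<zero>\<^bsub>K\<^esub>) \<and>
                   finite {s. f s \<noteq> \<zero>\<^bsub>K\<^esub>}},
     mult = undefined, one = undefined,
     zero = (\<lambda>s. \<zero>\<^bsub>K\<^esub>),
     add = (\<lambda>f g s. f s \<oplus>\<^bsub>K\<^esub> g s),
     smult = (\<lambda>k f s. k \<otimes>\<^bsub>K\<^esub> f s)\<rparr>"

definition free_gen :: "('k, 'm) ring_scheme \<Rightarrow> 's \<Rightarrow> 's \<Rightarrow> 'k"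
  where "free_gen K s = (\<lambda>t. if t = s then \<one>\<^bsub>K\<^esub> else \<zero>\<^bsub>K\<^esub>)"

definition quotient_module :: "('k, 'a, 'ma) module_scheme \<Rightarrow> 'a set \<Rightarrow> ('k, 'a set) module"
  where "quotient_module M N =
    \<lparr>carrier = a_rcosets\<^bsub>M\<^esub> N,
     mult = undefined, one = undefined,
     zero = N,
     add = set_add M,
     smult = (\<lambda>k X. \<Union>x\<in>X. N +>\<^bsub>M\<^esub> (k \<odot>\<^bsub>M\<^esub> x))\<rparr>"

definition submodule_generated ::
  "('k, 'm) ring_scheme \<Rightarrow> ('k, 'a, 'ma) module_scheme \<Rightarrow> 'a set \<Rightarrow> 'a set"
  where "submodule_generated K M S = \<Inter>{N. submodule N K M \<and> S \<subseteq> N}"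

definition tensor_relations ::
  "('k, 'm) ring_scheme \<Rightarrow> ('k, 'a, 'ma) module_scheme \<Rightarrow> ('k, 'b, 'mb) module_scheme
    \<Rightarrow> ('a \<times> 'b \<Rightarrow> 'k) set"
  where "tensor_relations K A B =
    (let F = free_module K (carrier A \<times> carrier B); \<delta> = (\<lambda>a b. free_gen K (a, b)) in
      {\<delta> (a \<oplus>\<^bsub>A\<^esub> a') b \<ominus>\<^bsub>F\<^esub> (\<delta> a b \<oplus>\<^bsub>F\<^esub> \<delta> a' b) | a a' b.
         a \<in> carrier A \<and> a' \<in> carrier A \<and> b \<in> carrier B} \<union>
      {\<delta> a (b \<oplus>\<^bsub>B\<^esub> b') \<ominus>\<^bsub>F\<^esub> (\<delta> a b \<oplus>\<^bsub>F\<^esub> \<delta> a b') | a b b'.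
         a \<in> carrier A \<and> b \<in> carrier B \<and> b' \<in> carrier B} \<union>
      {\<delta> (k \<odot>\<^bsub>A\<^esub> a) b \<ominus>\<^bsub>F\<^esub> (k \<odot>\<^bsub>F\<^esub> \<delta> a b) | k a b.
         k \<in> carrier K \<and> a \<in> carrier A \<and> b \<in> carrier B} \<union>
      {\<delta> a (k \<odot>\<^bsub>B\<^esub> b) \<ominus>\<^bsub>F\<^esub> (k \<odot>\<^bsub>F\<^esub> \<delta> a b) | k a b.
         k \<in> carrier K \<and> a \<in> carrier A \<and> b \<in> carrier B})"

definition tensor_kernel ::
  "('k, 'm) ring_scheme \<Rightarrow> ('k, 'a, 'ma) module_scheme \<Rightarrow> ('k, 'b, 'mb) module_scheme
    \<Rightarrow> ('a \<times> 'b \<Rightarrow> 'k) set"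
  where "tensor_kernel K A B =
    submodule_generated K (free_module K (carrier A \<times> carrier B)) (tensor_relations K A B)"

definition tensor_product ::
  "('k, 'm) ring_scheme \<Rightarrow> ('k, 'a, 'ma) module_scheme \<Rightarrow> ('k, 'b, 'mb) module_scheme
    \<Rightarrow> ('k, ('a \<times> 'b \<Rightarrow> 'k) set) module"
  where "tensor_product K A B =
    quotient_module (free_module K (carrier A \<times> carrier B)) (tensor_kernel K A B)"

definition pure_tensor ::
  "('k, 'm) ring_scheme \<Rightarrow> ('k, 'a, 'ma) module_scheme \<Rightarrow> ('k, 'b, 'mb) module_scheme
    \<Rightarrow> 'a \<Rightarrow> 'b \<Rightarrow> ('a \<times> 'b \<Rightarrow> 'k) set"
  where "pure_tensor K A B a b =
    tensor_kernel K A B +>\<^bsub>free_module K (carrier A \<times> carrier B)\<^esub> free_gen K (a, b)"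


section \<open>Maps on the tensor product given on pure tensors\<close>

text \<open>The values outside the carrier are fixed to make the descriptions unique; the existence of
  the described maps is shown in \<open>tensor_linear_extension\<close> and \<open>tensor_bilinear_extension\<close>
  below, the resulting formulas on pure tensors in \<open>tensor_map_pure\<close>, \<open>tensor_dot_pure\<close> and
  \<open>tensor_brk_pure\<close>.\<close>

definition tensor_linear ::
  "('k, 'm) ring_scheme \<Rightarrow> ('k, 'a, 'ma) module_scheme \<Rightarrow> ('k, 'b, 'mb) module_scheme
    \<Rightarrow> ('a \<Rightarrow> 'b \<Rightarrow> ('a \<times> 'b \<Rightarrow> 'k) set)
    \<Rightarrow> ('a \<times> 'b \<Rightarrow> 'k) set \<Rightarrow> ('a \<times> 'b \<Rightarrow> 'k) set"
  where "tensor_linear K A B \<phi> =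
    (THE h. linear_map K (tensor_product K A B) (tensor_product K A B) h \<and>
       (\<forall>a\<in>carrier A. \<forall>b\<in>carrier B. h (pure_tensor K A B a b) = \<phi> a b) \<and>
       (\<forall>X. X \<notin> carrier (tensor_product K A B) \<longrightarrow> h X = undefined))"

definition tensor_bilinear ::
  "('k, 'm) ring_scheme \<Rightarrow> ('k, 'a, 'ma) module_scheme \<Rightarrow> ('k, 'b, 'mb) module_scheme
    \<Rightarrow> ('a \<Rightarrow> 'b \<Rightarrow> 'a \<Rightarrow> 'b \<Rightarrow> ('a \<times> 'b \<Rightarrow> 'k) set)
    \<Rightarrow> ('a \<times> 'b \<Rightarrow> 'k) set \<Rightarrow> ('a \<times> 'b \<Rightarrow> 'k) set \<Rightarrow> ('a \<times> 'b \<Rightarrow> 'k) set"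
  where "tensor_bilinear K A B \<phi> =
    (THE m. bilinear_map K (tensor_product K A B) (tensor_product K A B) (tensor_product K A B) m \<and>
       (\<forall>a\<in>carrier A. \<forall>b\<in>carrier B. \<forall>a'\<in>carrier A. \<forall>b'\<in>carrier B.
          m (pure_tensor K A B a b) (pure_tensor K A B a' b') = \<phi> a b a' b') \<and>
       (\<forall>X Y. X \<notin> carrier (tensor_product K A B) \<or> Y \<notin> carrier (tensor_product K A B)
          \<longrightarrow> m X Y = undefined))"

definition tensor_map ::
  "('k, 'm) ring_scheme \<Rightarrow> ('k, 'a, 'ma) module_scheme \<Rightarrow> ('k, 'b, 'mb) module_scheme
    \<Rightarrow> ('a \<Rightarrow> 'a) \<Rightarrow> ('b \<Rightarrow> 'b)
    \<Rightarrow> ('a \<times> 'b \<Rightarrow> 'k) set \<Rightarrow> ('a \<times> 'b \<Rightarrow> 'k) set"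
  where "tensor_map K A B f g =
    tensor_linear K A B (\<lambda>a b. pure_tensor K A B (f a) (g b))"

definition tensor_dot ::
  "('k, 'm) ring_scheme \<Rightarrow> ('k, 'a, 'ma) module_scheme \<Rightarrow> ('k, 'b, 'mb) module_scheme
    \<Rightarrow> ('a \<Rightarrow> 'a \<Rightarrow> 'a) \<Rightarrow> ('b \<Rightarrow> 'b \<Rightarrow> 'b)
    \<Rightarrow> ('a \<times> 'b \<Rightarrow> 'k) set \<Rightarrow> ('a \<times> 'b \<Rightarrow> 'k) set \<Rightarrow> ('a \<times> 'b \<Rightarrow> 'k) set"
  where "tensor_dot K A B dotA dotB =
    tensor_bilinear K A B (\<lambda>a b a' b'. pure_tensor K A B (dotA a a') (dotB b b'))"

definition tensor_brk ::
  "('k, 'm) ring_scheme \<Rightarrow> ('k, 'a, 'ma) module_scheme \<Rightarrow> ('k, 'b, 'mb) module_scheme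
    \<Rightarrow> ('a \<Rightarrow> 'a \<Rightarrow> 'a) \<Rightarrow> ('a \<Rightarrow> 'a \<Rightarrow> 'a) \<Rightarrow> ('b \<Rightarrow> 'b \<Rightarrow> 'b) \<Rightarrow> ('b \<Rightarrow> 'b \<Rightarrow> 'b)
    \<Rightarrow> ('a \<times> 'b \<Rightarrow> 'k) set \<Rightarrow> ('a \<times> 'b \<Rightarrow> 'k) set \<Rightarrow> ('a \<times> 'b \<Rightarrow> 'k) set"
  where "tensor_brk K A B dotA brkA dotB brkB =
    tensor_bilinear K A B (\<lambda>a b a' b'.
      pure_tensor K A B (brkA a a') (dotB b b') \<oplus>\<^bsub>tensor_product K A B\<^esub>
      pure_tensor K A B (dotA a a') (brkB b b'))"


section \<open>The described maps exist\<close>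

lemma linear_mapD:
  assumes "linear_map K V W f"
  shows "x \<in> carrier V \<Longrightarrow> f x \<in> carrier W"
    and "\<lbrakk>x \<in> carrier V; y \<in> carrier V\<rbrakk> \<Longrightarrow> f (x \<oplus>\<^bsub>V\<^esub> y) = f x \<oplus>\<^bsub>W\<^esub> f y"
    and "\<lbrakk>k \<in> carrier K; x \<in> carrier V\<rbrakk> \<Longrightarrow> f (k \<odot>\<^bsub>V\<^esub> x) = k \<odot>\<^bsub>W\<^esub> f x"
  using assms by (auto simp: linear_map_def)

lemma linear_map_zero_minus:
  assumes "module K V" "module K W" "linear_map K V W f"
  shows "f \<zero>\<^bsub>V\<^esub> = \<zero>\<^bsub>W\<^esub>" and "x \<in> carrier V \<Longrightarrow> f (\<ominus>\<^bsub>V\<^esub> x) = \<ominus>\<^bsub>W\<^esub> f x"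
proof -
  interpret V: module K V by fact
  interpret W: module K W by fact
  note f = linear_mapD[OF assms(3)]
  show 0: "f \<zero>\<^bsub>V\<^esub> = \<zero>\<^bsub>W\<^esub>"
    using f(3)[of "\<zero>\<^bsub>K\<^esub>" "\<zero>\<^bsub>V\<^esub>"] f(1)[of "\<zero>\<^bsub>V\<^esub>"] by simp
  show "f (\<ominus>\<^bsub>V\<^esub> x) = \<ominus>\<^bsub>W\<^esub> f x" if "x \<in> carrier V"
    using f(2)[of "\<ominus>\<^bsub>V\<^esub> x" x] f(1)[of x] f(1)[of "\<ominus>\<^bsub>V\<^esub> x"] that 0
    by (simp add: V.M.l_neg W.M.minus_equality)
qed

lemma linear_map_kernel:
  assumes "module K V" "module K W" "linear_map K V W f"
  shows "submodule {x \<in> carrier V. f x = \<zero>\<^bsub>W\<^esub>} K V"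
proof -
  interpret V: module K V by fact
  interpret W: module K W by fact
  note f = linear_mapD[OF assms(3)] linear_map_zero_minus[OF assms]
  show ?thesis
    by (rule V.submoduleI) (auto simp: f)
qed

lemma linear_map_equalizer:
  assumes "module K V" "module K W" "linear_map K V W f" "linear_map K V W g"
  shows "submodule {x \<in> carrier V. f x = g x} K V"
proof -
  interpret V: module K V by fact
  interpret W: module K W by fact
  note f = linear_mapD[OF assms(3)] linear_map_zero_minus[OF assms(1-3)]
  note g = linear_mapD[OF assms(4)] linear_map_zero_minus[OF assms(1,2,4)]
  show ?thesis
    by (rule V.submoduleI) (auto simp: f g)
qed

lemma submodule_generated:
  assumes "module K M" "S \<subseteq> carrier M"
  shows "submodule (submodule_generated K M S) K M"
    and "S \<subseteq> submodule_generated K M S"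
    and "submodule N K M \<Longrightarrow> S \<subseteq> N \<Longrightarrow> submodule_generated K M S \<subseteq> N"
proof -
  interpret module K M by fact
  have c: "carrier M \<in> {N. submodule N K M \<and> S \<subseteq> N}"
    using assms(2) carrier_is_submodule by auto
  show "submodule (submodule_generated K M S) K M"
    unfolding submodule_generated_def
  proof (rule submoduleI)
    show "\<Inter>{N. submodule N K M \<and> S \<subseteq> N} \<subseteq> carrier M" using c by blast
    show "\<zero>\<^bsub>M\<^esub> \<in> \<Inter>{N. submodule N K M \<and> S \<subseteq> N}"
      using submodule.axioms(1) subgroup.one_closed by fastforce
  qed (auto dest: submoduleE(3-5))
qed (auto simp: submodule_generated_def)


subsection \<open>Properties of the free module\<close>

lemma free_module_simps:
  "\<zero>\<^bsub>free_module K S\<^esub> = (\<lambda>s. \<zero>\<^bsub>K\<^esub>)"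
  "f \<oplus>\<^bsub>free_module K S\<^esub> g = (\<lambda>s. f s \<oplus>\<^bsub>K\<^esub> g s)"
  "k \<odot>\<^bsub>free_module K S\<^esub> f = (\<lambda>s. k \<otimes>\<^bsub>K\<^esub> f s)"
  by (auto simp: free_module_def)

lemma free_module_carrier:
  "f \<in> carrier (free_module K S) \<longleftrightarrow> (\<forall>s\<in>S. f s \<in> carrier K) \<and>
     (\<forall>s. s \<notin> S \<longrightarrow> f s = \<zero>\<^bsub>K\<^esub>) \<and> finite {s. f s \<noteq> \<zero>\<^bsub>K\<^esub>}"
  by (simp add: free_module_def)

lemma module_free_module:
  assumes "cring K"
  shows "module K (free_module K S)"
proof -
  interpret cring K by fact
  have val: "f s \<in> carrier K" if "f \<in> carrier (free_module K S)" for f s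
    using that by (cases "s \<in> S") (auto simp: free_module_carrier)
  have addc: "(\<lambda>s. f s \<oplus>\<^bsub>K\<^esub> g s) \<in> carrier (free_module K S)"
    if "f \<in> carrier (free_module K S)" "g \<in> carrier (free_module K S)" for f g
  proof -
    have "{s. f s \<oplus>\<^bsub>K\<^esub> g s \<noteq> \<zero>\<^bsub>K\<^esub>} \<subseteq> {s. f s \<noteq> \<zero>\<^bsub>K\<^esub>} \<union> {s. g s \<noteq> \<zero>\<^bsub>K\<^esub>}" by auto
    then show ?thesis
      using that by (auto simp: free_module_carrier intro: finite_subset)
  qed
  have smultc: "(\<lambda>s. k \<otimes>\<^bsub>K\<^esub> f s) \<in> carrier (free_module K S)"
    if "k \<in> carrier K" "f \<in> carrier (free_module K S)" for k f
  proof -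
    have "{s. k \<otimes>\<^bsub>K\<^esub> f s \<noteq> \<zero>\<^bsub>K\<^esub>} \<subseteq> {s. f s \<noteq> \<zero>\<^bsub>K\<^esub>}" using that by auto
    then show ?thesis
      using that by (auto simp: free_module_carrier intro: finite_subset)
  qed
  have neg: "\<exists>g\<in>carrier (free_module K S). (\<lambda>s. g s \<oplus>\<^bsub>K\<^esub> f s) = (\<lambda>s. \<zero>\<^bsub>K\<^esub>)"
    if "f \<in> carrier (free_module K S)" for f
    using smultc[OF a_inv_closed[OF one_closed] that] val[OF that]
    by (intro bexI[of _ "\<lambda>s. (\<ominus>\<^bsub>K\<^esub> \<one>\<^bsub>K\<^esub>) \<otimes>\<^bsub>K\<^esub> f s"]) (auto simp: l_minus l_neg)
  have ab: "abelian_group (free_module K S)"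
  proof (rule abelian_groupI, goal_cases)
    case 2
    then show ?case by (simp add: free_module_carrier free_module_simps)
  next
    case (6 f)
    then show ?case using neg[of f] by (simp only: free_module_simps)
  qed (simp_all add: free_module_simps addc val a_assoc a_comm[OF val val])
  show ?thesis
    by (rule moduleI[OF assms ab])
      (auto simp: free_module_simps smultc val l_distr r_distr m_assoc)
qed

lemma free_gen_closed:
  assumes "cring K" "s \<in> S"
  shows "free_gen K s \<in> carrier (free_module K S)"
proof -
  interpret cring K by fact
  have "{t. free_gen K s t \<noteq> \<zero>\<^bsub>K\<^esub>} \<subseteq> {s}" by (auto simp: free_gen_def)
  then show ?thesis
    using assms(2) by (auto simp: free_module_carrier free_gen_def intro: finite_subset)
qed

lemma free_module_span:
  assumes "cring K" "submodule N K (free_module K S)" "\<And>s. s \<in> S \<Longrightarrow> free_gen K s \<in> N"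
  shows "carrier (free_module K S) \<subseteq> N"
proof
  interpret cring K by fact
  interpret F: module K "free_module K S" by (rule module_free_module) fact
  note N = F.submoduleE[OF assms(2)]
  have zero: "\<zero>\<^bsub>free_module K S\<^esub> \<in> N"
    using assms(2) submodule.axioms(1) subgroup.one_closed by fastforce
  fix f assume f: "f \<in> carrier (free_module K S)"
  have "finite I \<Longrightarrow> I \<subseteq> S \<Longrightarrow> (\<lambda>s. if s \<in> I then f s else \<zero>\<^bsub>K\<^esub>) \<in> N" for I
  proof (induction I rule: finite_induct)
    case empty
    then show ?case using zero by (simp add: free_module_simps)
  next
    case (insert i I)
    have fi: "f i \<in> carrier K" using f insert.prems by (auto simp: free_module_carrier)
    have fI: "f s \<in> carrier K" if "s \<in> I" for s
      using f insert.prems that by (auto simp: free_module_carrier)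
    have "(\<lambda>s. if s \<in> I then f s else \<zero>\<^bsub>K\<^esub>) \<oplus>\<^bsub>free_module K S\<^esub>
        (f i \<odot>\<^bsub>free_module K S\<^esub> free_gen K i) \<in> N"
      using insert.IH insert.prems assms(3) fi by (intro N(4,5)) auto
    also have "(\<lambda>s. if s \<in> I then f s else \<zero>\<^bsub>K\<^esub>) \<oplus>\<^bsub>free_module K S\<^esub>
        (f i \<odot>\<^bsub>free_module K S\<^esub> free_gen K i) = (\<lambda>s. if s \<in> insert i I then f s else \<zero>\<^bsub>K\<^esub>)"
      using insert.hyps fi fI by (auto simp: free_module_simps free_gen_def)
    finally show ?case .
  qed
  from this[of "{s. f s \<noteq> \<zero>\<^bsub>K\<^esub>}"]
  have "(\<lambda>s. if s \<in> {s. f s \<noteq> \<zero>\<^bsub>K\<^esub>} then f s else \<zero>\<^bsub>K\<^esub>) \<in> N"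
    using f by (auto simp: free_module_carrier)
  also have "(\<lambda>s. if s \<in> {s. f s \<noteq> \<zero>\<^bsub>K\<^esub>} then f s else \<zero>\<^bsub>K\<^esub>) = f" by auto
  finally show "f \<in> N" .
qed

lemma free_module_extension:
  assumes "module K W" "\<phi> \<in> S \<rightarrow> carrier W"
  obtains h where "linear_map K (free_module K S) W h"
    and "\<And>s. s \<in> S \<Longrightarrow> h (free_gen K s) = \<phi> s"
proof -
  interpret W: module K W by fact
  define h where "h f = (\<Oplus>\<^bsub>W\<^esub>s\<in>{s. f s \<noteq> \<zero>\<^bsub>K\<^esub>}. f s \<odot>\<^bsub>W\<^esub> \<phi> s)" for f
  have h: "h f = (\<Oplus>\<^bsub>W\<^esub>s\<in>I. f s \<odot>\<^bsub>W\<^esub> \<phi> s)"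
    if "f \<in> carrier (free_module K S)" "finite I" "{s. f s \<noteq> \<zero>\<^bsub>K\<^esub>} \<subseteq> I" "I \<subseteq> S" for f I
    unfolding h_def
  proof (rule W.M.add.finprod_mono_neutral_cong_left)
    show "(\<lambda>s. f s \<odot>\<^bsub>W\<^esub> \<phi> s) \<in> I \<rightarrow> carrier W"
      using that(1,4) assms(2) by (intro funcsetI W.smult_closed) (auto simp: free_module_carrier)
    show "f s \<odot>\<^bsub>W\<^esub> \<phi> s = \<zero>\<^bsub>W\<^esub>" if "s \<in> I - {s. f s \<noteq> \<zero>\<^bsub>K\<^esub>}" for s
    proof -
      have "\<phi> s \<in> carrier W" using that \<open>I \<subseteq> S\<close> assms(2) by blast
      then show ?thesis using that by simp
    qed
  qed (use that in simp_all)
  have hcl: "f s \<odot>\<^bsub>W\<^esub> \<phi> s \<in> carrier W" if "f \<in> carrier (free_module K S)" "s \<in> S" for f s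
    using that assms(2) by (auto simp: free_module_carrier)
  interpret F: module K "free_module K S" by (rule module_free_module) (rule W.R.is_cring)
  have supp: "{s. f s \<noteq> \<zero>\<^bsub>K\<^esub>} \<subseteq> S" "finite {s. f s \<noteq> \<zero>\<^bsub>K\<^esub>}"
    if "f \<in> carrier (free_module K S)" for f
    using that by (auto simp: free_module_carrier)
  show ?thesis
  proof
    show "linear_map K (free_module K S) W h"
      unfolding linear_map_def
    proof (intro conjI ballI funcsetI)
      fix f assume f: "f \<in> carrier (free_module K S)"
      let ?I = "{s. f s \<noteq> \<zero>\<^bsub>K\<^esub>}"
      show "h f \<in> carrier W"
        unfolding h_def using supp[OF f] by (intro W.M.finsum_closed) (auto intro: hcl[OF f])
      show "h (k \<odot>\<^bsub>free_module K S\<^esub> f) = k \<odot>\<^bsub>W\<^esub> h f" if k: "k \<in> carrier K" for k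
      proof -
        have "h (k \<odot>\<^bsub>free_module K S\<^esub> f) = (\<Oplus>\<^bsub>W\<^esub>s\<in>?I. (k \<odot>\<^bsub>free_module K S\<^esub> f) s \<odot>\<^bsub>W\<^esub> \<phi> s)"
          using f k supp[OF f] by (intro h F.smult_closed) (auto simp: free_module_simps)
        also have "\<dots> = (\<Oplus>\<^bsub>W\<^esub>s\<in>?I. k \<odot>\<^bsub>W\<^esub> (f s \<odot>\<^bsub>W\<^esub> \<phi> s))"
        proof (rule W.M.finsum_cong')
          show "(\<lambda>s. k \<odot>\<^bsub>W\<^esub> (f s \<odot>\<^bsub>W\<^esub> \<phi> s)) \<in> ?I \<rightarrow> carrier W"
            using hcl[OF f] supp(1)[OF f] k by (simp add: Pi_iff subset_iff)
          show "(k \<odot>\<^bsub>free_module K S\<^esub> f) s \<odot>\<^bsub>W\<^esub> \<phi> s = k \<odot>\<^bsub>W\<^esub> (f s \<odot>\<^bsub>W\<^esub> \<phi> s)"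
            if "s \<in> ?I" for s
          proof -
            have "s \<in> S" using that supp(1)[OF f] by blast
            then have "f s \<in> carrier K" "\<phi> s \<in> carrier W"
              using f assms(2) by (auto simp: free_module_carrier)
            then show ?thesis using k by (simp add: free_module_simps W.smult_assoc1)
          qed
        qed simp
        also have "\<dots> = k \<odot>\<^bsub>W\<^esub> h f"
          unfolding h_def using supp[OF f] k
          by (intro W.finsum_smult_ldistr[symmetric]) (auto intro: hcl[OF f])
        finally show ?thesis .
      qed
      fix g assume g: "g \<in> carrier (free_module K S)"
      let ?J = "?I \<union> {s. g s \<noteq> \<zero>\<^bsub>K\<^esub>}"
      have J: "finite ?J" "?J \<subseteq> S" using supp[OF f] supp[OF g] by auto
      have "h (f \<oplus>\<^bsub>free_module K S\<^esub> g) = (\<Oplus>\<^bsub>W\<^esub>s\<in>?J. (f \<oplus>\<^bsub>free_module K S\<^esub> g) s \<odot>\<^bsub>W\<^esub> \<phi> s)"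
        using f g J by (intro h F.M.a_closed) (auto simp: free_module_simps)
      also have "\<dots> = (\<Oplus>\<^bsub>W\<^esub>s\<in>?J. f s \<odot>\<^bsub>W\<^esub> \<phi> s \<oplus>\<^bsub>W\<^esub> g s \<odot>\<^bsub>W\<^esub> \<phi> s)"
      proof (rule W.M.finsum_cong')
        show "(\<lambda>s. f s \<odot>\<^bsub>W\<^esub> \<phi> s \<oplus>\<^bsub>W\<^esub> g s \<odot>\<^bsub>W\<^esub> \<phi> s) \<in> ?J \<rightarrow> carrier W"
          using hcl[OF f] hcl[OF g] J(2) by (simp add: Pi_iff subset_iff)
        show "(f \<oplus>\<^bsub>free_module K S\<^esub> g) s \<odot>\<^bsub>W\<^esub> \<phi> s = f s \<odot>\<^bsub>W\<^esub> \<phi> s \<oplus>\<^bsub>W\<^esub> g s \<odot>\<^bsub>W\<^esub> \<phi> s"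
          if "s \<in> ?J" for s
        proof -
          have "s \<in> S" using that J(2) by blast
          then have "f s \<in> carrier K" "g s \<in> carrier K" "\<phi> s \<in> carrier W"
            using f g assms(2) by (auto simp: free_module_carrier)
          then show ?thesis by (simp add: free_module_simps W.smult_l_distr)
        qed
      qed simp
      also have "\<dots> = (\<Oplus>\<^bsub>W\<^esub>s\<in>?J. f s \<odot>\<^bsub>W\<^esub> \<phi> s) \<oplus>\<^bsub>W\<^esub> (\<Oplus>\<^bsub>W\<^esub>s\<in>?J. g s \<odot>\<^bsub>W\<^esub> \<phi> s)"
        using hcl[OF f] hcl[OF g] J by (intro W.M.finsum_addf) (simp_all add: Pi_iff subset_iff)
      also have "\<dots> = h f \<oplus>\<^bsub>W\<^esub> h g"
        using h[OF f J(1) _ J(2)] h[OF g J(1) _ J(2)] by auto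
      finally show "h (f \<oplus>\<^bsub>free_module K S\<^esub> g) = h f \<oplus>\<^bsub>W\<^esub> h g" .
    qed
    show "h (free_gen K s) = \<phi> s" if "s \<in> S" for s
    proof -
      have "h (free_gen K s) = (\<Oplus>\<^bsub>W\<^esub>t\<in>{s}. free_gen K s t \<odot>\<^bsub>W\<^esub> \<phi> t)"
        using that by (intro h free_gen_closed W.R.is_cring) (auto simp: free_gen_def)
      moreover have "\<phi> s \<in> carrier W" using that assms(2) by blast
      ultimately show ?thesis by (simp add: free_gen_def)
    qed
  qed
qed


subsection \<open>Properties of the quotient module\<close>

lemma quotient_module_simps:
  "carrier (quotient_module M N) = a_rcosets\<^bsub>M\<^esub> N"
  "\<zero>\<^bsub>quotient_module M N\<^esub> = N"
  "X \<oplus>\<^bsub>quotient_module M N\<^esub> Y = X <+>\<^bsub>M\<^esub> Y"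
  "k \<odot>\<^bsub>quotient_module M N\<^esub> X = (\<Union>x\<in>X. N +>\<^bsub>M\<^esub> (k \<odot>\<^bsub>M\<^esub> x))"
  by (auto simp: quotient_module_def)

context
  fixes K :: "('k, 'm) ring_scheme" and M :: "('k, 'a, 'ma) module_scheme" and N
  assumes M: "module K M" and N: "submodule N K M"
begin

interpretation M: module K M by (rule M)

interpretation N: abelian_subgroup N M
  by (rule abelian_subgroupI3)
    (auto intro: additive_subgroupI submodule.axioms(1)[OF N] M.M.abelian_group_axioms)

lemma quotient_module_carrier:
  "carrier (quotient_module M N) = (\<lambda>x. N +>\<^bsub>M\<^esub> x) ` carrier M"
  by (auto simp: quotient_module_simps A_RCOSETS_def')

lemma coset_smult:
  assumes "k \<in> carrier K" "x \<in> carrier M"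
  shows "k \<odot>\<^bsub>quotient_module M N\<^esub> (N +>\<^bsub>M\<^esub> x) = N +>\<^bsub>M\<^esub> (k \<odot>\<^bsub>M\<^esub> x)"
proof -
  have "N +>\<^bsub>M\<^esub> (k \<odot>\<^bsub>M\<^esub> y) = N +>\<^bsub>M\<^esub> (k \<odot>\<^bsub>M\<^esub> x)" if y: "y \<in> N +>\<^bsub>M\<^esub> x" for y
  proof -
    obtain n where n: "n \<in> N" "y = n \<oplus>\<^bsub>M\<^esub> x" using y by (auto simp: a_r_coset_def')
    have "k \<odot>\<^bsub>M\<^esub> y = (k \<odot>\<^bsub>M\<^esub> n) \<oplus>\<^bsub>M\<^esub> (k \<odot>\<^bsub>M\<^esub> x)"
      using n assms by (simp add: M.smult_r_distr)
    moreover have "k \<odot>\<^bsub>M\<^esub> n \<in> N" using submodule.smult_closed[OF N] n assms by auto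
    ultimately have "k \<odot>\<^bsub>M\<^esub> y \<in> N +>\<^bsub>M\<^esub> (k \<odot>\<^bsub>M\<^esub> x)" by (auto simp: a_r_coset_def')
    then show ?thesis
      using N.a_repr_independence'[OF _ M.smult_closed[OF assms]] by simp
  qed
  moreover have "x \<in> N +>\<^bsub>M\<^esub> x" using assms N.a_rcos_self by simp
  ultimately show ?thesis
    unfolding quotient_module_simps by (intro SUP_eq_const) blast+
qed

lemma coset_add:
  "\<lbrakk>x \<in> carrier M; y \<in> carrier M\<rbrakk> \<Longrightarrow>
    (N +>\<^bsub>M\<^esub> x) \<oplus>\<^bsub>quotient_module M N\<^esub> (N +>\<^bsub>M\<^esub> y) = N +>\<^bsub>M\<^esub> (x \<oplus>\<^bsub>M\<^esub> y)"
  by (simp add: quotient_module_simps N.a_rcos_sum)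

lemma coset_zero: "\<zero>\<^bsub>quotient_module M N\<^esub> = N +>\<^bsub>M\<^esub> \<zero>\<^bsub>M\<^esub>"
  by (simp add: quotient_module_simps N.a_rcos_const)

lemma quotient_module_cases:
  assumes "X \<in> carrier (quotient_module M N)"
  obtains x where "x \<in> carrier M" "X = N +>\<^bsub>M\<^esub> x"
  using assms by (auto simp: quotient_module_carrier)

lemma coset_closed: "x \<in> carrier M \<Longrightarrow> N +>\<^bsub>M\<^esub> x \<in> carrier (quotient_module M N)"
  by (simp add: quotient_module_carrier)

lemma module_quotient_module: "module K (quotient_module M N)"
proof (rule moduleI[OF M.R.is_cring])
  note coset_simps = coset_closed coset_add coset_smult coset_zero
  show "abelian_group (quotient_module M N)"
  proof (rule abelian_groupI, goal_cases)
    case (6 X)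
    then obtain x where x: "x \<in> carrier M" "X = N +>\<^bsub>M\<^esub> x"
      by (rule quotient_module_cases)
    then show ?case
      by (intro bexI[of _ "N +>\<^bsub>M\<^esub> (\<ominus>\<^bsub>M\<^esub> x)"]) (simp_all add: coset_simps M.M.l_neg)
  qed (auto elim!: quotient_module_cases simp: coset_simps M.M.a_ac)
  fix X assume "X \<in> carrier (quotient_module M N)"
  then obtain x where x: "x \<in> carrier M" and X: "X = N +>\<^bsub>M\<^esub> x"
    by (rule quotient_module_cases)
  show "\<one>\<^bsub>K\<^esub> \<odot>\<^bsub>quotient_module M N\<^esub> X = X"
    using x by (simp add: X coset_simps)
  fix k assume k: "k \<in> carrier K"
  show "k \<odot>\<^bsub>quotient_module M N\<^esub> X \<in> carrier (quotient_module M N)"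
    using k x by (simp add: X coset_simps)
  show "(k \<oplus>\<^bsub>K\<^esub> l) \<odot>\<^bsub>quotient_module M N\<^esub> X =
      k \<odot>\<^bsub>quotient_module M N\<^esub> X \<oplus>\<^bsub>quotient_module M N\<^esub> l \<odot>\<^bsub>quotient_module M N\<^esub> X"
    if "l \<in> carrier K" for l
    using k x that by (simp add: X coset_simps M.smult_l_distr)
  show "(k \<otimes>\<^bsub>K\<^esub> l) \<odot>\<^bsub>quotient_module M N\<^esub> X =
      k \<odot>\<^bsub>quotient_module M N\<^esub> (l \<odot>\<^bsub>quotient_module M N\<^esub> X)"
    if "l \<in> carrier K" for l
    using k x that by (simp add: X coset_simps M.smult_assoc1)
  fix Y assume "Y \<in> carrier (quotient_module M N)"
  then obtain y where y: "y \<in> carrier M" and Y: "Y = N +>\<^bsub>M\<^esub> y"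
    by (rule quotient_module_cases)
  show "k \<odot>\<^bsub>quotient_module M N\<^esub> (X \<oplus>\<^bsub>quotient_module M N\<^esub> Y) =
      k \<odot>\<^bsub>quotient_module M N\<^esub> X \<oplus>\<^bsub>quotient_module M N\<^esub> k \<odot>\<^bsub>quotient_module M N\<^esub> Y"
    using k x y by (simp add: X Y coset_simps M.smult_r_distr)
qed

lemma linear_map_coset: "linear_map K M (quotient_module M N) (\<lambda>x. N +>\<^bsub>M\<^esub> x)"
  by (simp add: linear_map_def coset_closed coset_add coset_smult)

lemma quotient_module_extension:
  assumes W: "module K W" and h: "linear_map K M W h"
    and 0: "\<And>x. x \<in> N \<Longrightarrow> h x = \<zero>\<^bsub>W\<^esub>"
  obtains g where "linear_map K (quotient_module M N) W g"
    and "\<And>x. x \<in> carrier M \<Longrightarrow> g (N +>\<^bsub>M\<^esub> x) = h x"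
proof
  interpret W: module K W by fact
  note h = linear_mapD[OF h]
  let ?g = "\<lambda>X. h (SOME x. x \<in> X)"
  show g: "?g (N +>\<^bsub>M\<^esub> x) = h x" if x: "x \<in> carrier M" for x
  proof -
    have "(SOME y. y \<in> N +>\<^bsub>M\<^esub> x) \<in> N +>\<^bsub>M\<^esub> x"
      using N.a_rcos_self[OF x] by (rule someI)
    then obtain n where "n \<in> N" "(SOME y. y \<in> N +>\<^bsub>M\<^esub> x) = n \<oplus>\<^bsub>M\<^esub> x"
      by (auto simp: a_r_coset_def')
    then show ?thesis using x 0 h by simp
  qed
  show "linear_map K (quotient_module M N) W ?g"
    unfolding linear_map_def
  proof (intro conjI ballI funcsetI)
    fix X assume "X \<in> carrier (quotient_module M N)"
    then obtain x where x: "x \<in> carrier M" "X = N +>\<^bsub>M\<^esub> x"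
      by (auto simp: quotient_module_carrier)
    show "?g X \<in> carrier W"
      using x h(1) by (simp only: g)
    show "?g (k \<odot>\<^bsub>quotient_module M N\<^esub> X) = k \<odot>\<^bsub>W\<^esub> ?g X" if "k \<in> carrier K" for k
      using x h(3) that by (simp only: g coset_smult M.smult_closed)
    fix Y assume "Y \<in> carrier (quotient_module M N)"
    then obtain y where y: "y \<in> carrier M" "Y = N +>\<^bsub>M\<^esub> y"
      by (auto simp: quotient_module_carrier)
    show "?g (X \<oplus>\<^bsub>quotient_module M N\<^esub> Y) = ?g X \<oplus>\<^bsub>W\<^esub> ?g Y"
      using x y h(2) by (simp only: g coset_add M.M.a_closed)
  qed
qed

lemma coset_eqI:
  assumes "x \<in> carrier M" "y \<in> carrier M" "x \<ominus>\<^bsub>M\<^esub> y \<in> N"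
  shows "N +>\<^bsub>M\<^esub> x = N +>\<^bsub>M\<^esub> y"
proof -
  have "x \<in> N +>\<^bsub>M\<^esub> y"
    using assms by (intro N.a_rcos_module_rev) (auto simp: a_minus_def)
  then show ?thesis using N.a_repr_independence'[of x y] assms by simp
qed

end


subsection \<open>The universal property of the tensor product\<close>

lemma bilinear_mapD:
  assumes "bilinear_map K V W U f"
  shows "\<lbrakk>x \<in> carrier V; y \<in> carrier W\<rbrakk> \<Longrightarrow> f x y \<in> carrier U"
    and "\<lbrakk>x \<in> carrier V; x' \<in> carrier V; y \<in> carrier W\<rbrakk> \<Longrightarrow>
      f (x \<oplus>\<^bsub>V\<^esub> x') y = f x y \<oplus>\<^bsub>U\<^esub> f x' y"
    and "\<lbrakk>x \<in> carrier V; y \<in> carrier W; y' \<in> carrier W\<rbrakk> \<Longrightarrow>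
      f x (y \<oplus>\<^bsub>W\<^esub> y') = f x y \<oplus>\<^bsub>U\<^esub> f x y'"
    and "\<lbrakk>k \<in> carrier K; x \<in> carrier V; y \<in> carrier W\<rbrakk> \<Longrightarrow> f (k \<odot>\<^bsub>V\<^esub> x) y = k \<odot>\<^bsub>U\<^esub> f x y"
    and "\<lbrakk>k \<in> carrier K; x \<in> carrier V; y \<in> carrier W\<rbrakk> \<Longrightarrow> f x (k \<odot>\<^bsub>W\<^esub> y) = k \<odot>\<^bsub>U\<^esub> f x y"
  using assms by (auto simp: bilinear_map_def linear_map_def)

lemma bilinear_mapI:
  assumes "\<And>x y. \<lbrakk>x \<in> carrier V; y \<in> carrier W\<rbrakk> \<Longrightarrow> f x y \<in> carrier U"
    and "\<And>x x' y. \<lbrakk>x \<in> carrier V; x' \<in> carrier V; y \<in> carrier W\<rbrakk> \<Longrightarrow>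
      f (x \<oplus>\<^bsub>V\<^esub> x') y = f x y \<oplus>\<^bsub>U\<^esub> f x' y"
    and "\<And>x y y'. \<lbrakk>x \<in> carrier V; y \<in> carrier W; y' \<in> carrier W\<rbrakk> \<Longrightarrow>
      f x (y \<oplus>\<^bsub>W\<^esub> y') = f x y \<oplus>\<^bsub>U\<^esub> f x y'"
    and "\<And>k x y. \<lbrakk>k \<in> carrier K; x \<in> carrier V; y \<in> carrier W\<rbrakk> \<Longrightarrow>
      f (k \<odot>\<^bsub>V\<^esub> x) y = k \<odot>\<^bsub>U\<^esub> f x y"
    and "\<And>k x y. \<lbrakk>k \<in> carrier K; x \<in> carrier V; y \<in> carrier W\<rbrakk> \<Longrightarrow>
      f x (k \<odot>\<^bsub>W\<^esub> y) = k \<odot>\<^bsub>U\<^esub> f x y"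
  shows "bilinear_map K V W U f"
  using assms by (simp add: bilinear_map_def linear_map_def)

context
  fixes K :: "('k, 'm) ring_scheme"
    and A :: "('k, 'a, 'ma) module_scheme" and B :: "('k, 'b, 'mb) module_scheme"
  assumes A: "module K A" and B: "module K B"
begin

interpretation A: module K A by (rule A)
interpretation B: module K B by (rule B)

private abbreviation (input) "F \<equiv> free_module K (carrier A \<times> carrier B)"
private abbreviation (input) "N \<equiv> tensor_kernel K A B"
private abbreviation (input) "T \<equiv> tensor_product K A B"
private abbreviation (input) "\<delta> a b \<equiv> free_gen K (a, b)"
private abbreviation (input) "p \<equiv> pure_tensor K A B"

interpretation F: module K F by (rule module_free_module) (rule A.R.is_cring)

private lemma \<delta>_closed: "\<lbrakk>a \<in> carrier A; b \<in> carrier B\<rbrakk> \<Longrightarrow> \<delta> a b \<in> carrier F"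
  by (intro free_gen_closed A.R.is_cring) simp

lemma tensor_relations_subset: "tensor_relations K A B \<subseteq> carrier F"
  unfolding tensor_relations_def Let_def
  by (intro Un_least; clarify; intro F.M.minus_closed F.M.a_closed F.smult_closed \<delta>_closed)
    simp_all

lemmas tensor_kernel =
  submodule_generated[OF F.module_axioms tensor_relations_subset, folded tensor_kernel_def]

lemma module_tensor_product: "module K T"
  unfolding tensor_product_def by (intro module_quotient_module F.module_axioms tensor_kernel)

interpretation T: module K T by (rule module_tensor_product)

lemma bilinear_pure_tensor: "bilinear_map K A B T p"
proof -
  note q = linear_mapD[OF linear_map_coset[OF F.module_axioms tensor_kernel(1)],
      folded tensor_product_def]
  note eq = coset_eqI[OF F.module_axioms tensor_kernel(1)]
  show ?thesis
  proof (rule bilinear_mapI, unfold pure_tensor_def)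
    fix a b assume a: "a \<in> carrier A" and b: "b \<in> carrier B"
    show "N +>\<^bsub>F\<^esub> \<delta> a b \<in> carrier T" using a b by (intro q \<delta>_closed)
    {
      fix a' assume a': "a' \<in> carrier A"
      have "\<delta> (a \<oplus>\<^bsub>A\<^esub> a') b \<ominus>\<^bsub>F\<^esub> (\<delta> a b \<oplus>\<^bsub>F\<^esub> \<delta> a' b) \<in> N"
        using a a' b by (intro subsetD[OF tensor_kernel(2)]) (unfold tensor_relations_def Let_def, blast)
      then have "N +>\<^bsub>F\<^esub> \<delta> (a \<oplus>\<^bsub>A\<^esub> a') b = N +>\<^bsub>F\<^esub> (\<delta> a b \<oplus>\<^bsub>F\<^esub> \<delta> a' b)"
        using a a' b by (intro eq) (simp_all add: \<delta>_closed)
      then show "N +>\<^bsub>F\<^esub> \<delta> (a \<oplus>\<^bsub>A\<^esub> a') b = (N +>\<^bsub>F\<^esub> \<delta> a b) \<oplus>\<^bsub>T\<^esub> (N +>\<^bsub>F\<^esub> \<delta> a' b)"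
        using a a' b by (simp add: q \<delta>_closed)
    }
    {
      fix b' assume b': "b' \<in> carrier B"
      have "\<delta> a (b \<oplus>\<^bsub>B\<^esub> b') \<ominus>\<^bsub>F\<^esub> (\<delta> a b \<oplus>\<^bsub>F\<^esub> \<delta> a b') \<in> N"
        using a b b' by (intro subsetD[OF tensor_kernel(2)]) (unfold tensor_relations_def Let_def, blast)
      then have "N +>\<^bsub>F\<^esub> \<delta> a (b \<oplus>\<^bsub>B\<^esub> b') = N +>\<^bsub>F\<^esub> (\<delta> a b \<oplus>\<^bsub>F\<^esub> \<delta> a b')"
        using a b b' by (intro eq) (simp_all add: \<delta>_closed)
      then show "N +>\<^bsub>F\<^esub> \<delta> a (b \<oplus>\<^bsub>B\<^esub> b') = (N +>\<^bsub>F\<^esub> \<delta> a b) \<oplus>\<^bsub>T\<^esub> (N +>\<^bsub>F\<^esub> \<delta> a b')"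
        using a b b' by (simp add: q \<delta>_closed)
    }
    fix k assume k: "k \<in> carrier K"
    have "\<delta> (k \<odot>\<^bsub>A\<^esub> a) b \<ominus>\<^bsub>F\<^esub> (k \<odot>\<^bsub>F\<^esub> \<delta> a b) \<in> N" "\<delta> a (k \<odot>\<^bsub>B\<^esub> b) \<ominus>\<^bsub>F\<^esub> (k \<odot>\<^bsub>F\<^esub> \<delta> a b) \<in> N"
      using k a b by (intro subsetD[OF tensor_kernel(2)]; unfold tensor_relations_def Let_def, blast)+
    then have "N +>\<^bsub>F\<^esub> \<delta> (k \<odot>\<^bsub>A\<^esub> a) b = N +>\<^bsub>F\<^esub> (k \<odot>\<^bsub>F\<^esub> \<delta> a b)"
        "N +>\<^bsub>F\<^esub> \<delta> a (k \<odot>\<^bsub>B\<^esub> b) = N +>\<^bsub>F\<^esub> (k \<odot>\<^bsub>F\<^esub> \<delta> a b)"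
      using k a b by (intro eq; simp add: \<delta>_closed)+
    then show "N +>\<^bsub>F\<^esub> \<delta> (k \<odot>\<^bsub>A\<^esub> a) b = k \<odot>\<^bsub>T\<^esub> (N +>\<^bsub>F\<^esub> \<delta> a b)"
        "N +>\<^bsub>F\<^esub> \<delta> a (k \<odot>\<^bsub>B\<^esub> b) = k \<odot>\<^bsub>T\<^esub> (N +>\<^bsub>F\<^esub> \<delta> a b)"
      using k a b by (simp_all add: q \<delta>_closed)
  qed
qed

lemmas pure_tensor_closed = bilinear_mapD(1)[OF bilinear_pure_tensor]

lemma tensor_span:
  assumes P: "submodule P K T"
    and pure: "\<And>a b. \<lbrakk>a \<in> carrier A; b \<in> carrier B\<rbrakk> \<Longrightarrow> p a b \<in> P"
    and X: "X \<in> carrier T"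
  shows "X \<in> P"
proof -
  note lin = linear_map_coset[OF F.module_axioms tensor_kernel(1), folded tensor_product_def]
  note q = linear_mapD[OF lin] linear_map_zero_minus[OF F.module_axioms T.module_axioms lin]
  note P' = T.submoduleE[OF P]
  have zero: "\<zero>\<^bsub>T\<^esub> \<in> P" using submodule.axioms(1)[OF P] subgroup.one_closed by fastforce
  have "submodule {x \<in> carrier F. N +>\<^bsub>F\<^esub> x \<in> P} K F"
    by (rule F.submoduleI) (simp_all add: q P' zero subset_iff)
  then have "carrier F \<subseteq> {x \<in> carrier F. N +>\<^bsub>F\<^esub> x \<in> P}"
    using pure by (intro free_module_span A.R.is_cring) (auto simp: \<delta>_closed pure_tensor_def)
  moreover obtain x where "x \<in> carrier F" "X = N +>\<^bsub>F\<^esub> x"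
    using X unfolding tensor_product_def
    by (rule quotient_module_cases[OF F.module_axioms tensor_kernel(1)])
  ultimately show ?thesis by blast
qed

lemma tensor_linear_unique:
  assumes "module K W" "linear_map K T W f" "linear_map K T W g"
    and "\<And>a b. \<lbrakk>a \<in> carrier A; b \<in> carrier B\<rbrakk> \<Longrightarrow> f (p a b) = g (p a b)"
    and "X \<in> carrier T"
  shows "f X = g X"
  using tensor_span[OF linear_map_equalizer[OF T.module_axioms assms(1-3)] _ assms(5)] assms(4)
  by (simp add: pure_tensor_closed)

lemma tensor_universal:
  assumes W: "module K W" and \<phi>: "bilinear_map K A B W \<phi>"
  obtains h where "linear_map K T W h"
    and "\<And>a b. \<lbrakk>a \<in> carrier A; b \<in> carrier B\<rbrakk> \<Longrightarrow> h (p a b) = \<phi> a b"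
proof -
  interpret W: module K W by (rule W)
  note \<phi> = bilinear_mapD[OF \<phi>]
  obtain f where f: "linear_map K F W f"
    and f\<delta>: "\<And>s. s \<in> carrier A \<times> carrier B \<Longrightarrow> f (free_gen K s) = case_prod \<phi> s"
    by (rule free_module_extension[OF W, of "case_prod \<phi>" "carrier A \<times> carrier B"])
      (auto simp: \<phi>)
  note lin = linear_mapD[OF f] linear_map_zero_minus[OF F.module_axioms W f]
  have "tensor_relations K A B \<subseteq> {x \<in> carrier F. f x = \<zero>\<^bsub>W\<^esub>}"
  proof -
    have "f x = \<zero>\<^bsub>W\<^esub>" if "x \<in> tensor_relations K A B" for x
      using that unfolding tensor_relations_def Let_def
      by (elim UnE; clarsimp simp: a_minus_def lin f\<delta> \<delta>_closed \<phi> W.M.r_neg)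
    then show ?thesis using tensor_relations_subset by blast
  qed
  then have "N \<subseteq> {x \<in> carrier F. f x = \<zero>\<^bsub>W\<^esub>}"
    by (rule tensor_kernel(3)[OF linear_map_kernel[OF F.module_axioms W f]])
  then obtain h where h: "linear_map K T W h" "\<And>x. x \<in> carrier F \<Longrightarrow> h (N +>\<^bsub>F\<^esub> x) = f x"
    using quotient_module_extension[OF F.module_axioms tensor_kernel(1) W f]
    unfolding tensor_product_def by blast
  show ?thesis
    by (rule that[OF h(1)]) (simp add: pure_tensor_def h(2) \<delta>_closed f\<delta>)
qed

lemma tensor_linear_extension:
  assumes \<phi>: "bilinear_map K A B T \<phi>"
  shows "linear_map K T T (tensor_linear K A B \<phi>)"
    and "\<lbrakk>a \<in> carrier A; b \<in> carrier B\<rbrakk> \<Longrightarrow> tensor_linear K A B \<phi> (p a b) = \<phi> a b"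
proof -
  obtain f where f: "linear_map K T T f"
      "\<And>a b. \<lbrakk>a \<in> carrier A; b \<in> carrier B\<rbrakk> \<Longrightarrow> f (p a b) = \<phi> a b"
    using tensor_universal[OF T.module_axioms \<phi>] by blast
  define g where "g X = (if X \<in> carrier T then f X else undefined)" for X
  have g: "linear_map K T T g"
    using f(1) by (simp add: linear_map_def g_def Pi_iff)
  have "linear_map K T T (tensor_linear K A B \<phi>) \<and>
      (\<forall>a\<in>carrier A. \<forall>b\<in>carrier B. tensor_linear K A B \<phi> (p a b) = \<phi> a b) \<and>
      (\<forall>X. X \<notin> carrier T \<longrightarrow> tensor_linear K A B \<phi> X = undefined)"
    (is "?P (tensor_linear K A B \<phi>)") unfolding tensor_linear_def
  proof (rule theI[where P = ?P])
    show "linear_map K T T g \<and> (\<forall>a\<in>carrier A. \<forall>b\<in>carrier B. g (p a b) = \<phi> a b) \<and>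
        (\<forall>X. X \<notin> carrier T \<longrightarrow> g X = undefined)"
      using g f(2) by (simp add: g_def pure_tensor_closed)
    then show "h = g" if "linear_map K T T h \<and>
        (\<forall>a\<in>carrier A. \<forall>b\<in>carrier B. h (p a b) = \<phi> a b) \<and>
        (\<forall>X. X \<notin> carrier T \<longrightarrow> h X = undefined)" for h
      using that tensor_linear_unique[OF T.module_axioms, of h g] by (intro ext) metis
  qed
  then show "linear_map K T T (tensor_linear K A B \<phi>)"
    and "\<lbrakk>a \<in> carrier A; b \<in> carrier B\<rbrakk> \<Longrightarrow> tensor_linear K A B \<phi> (p a b) = \<phi> a b"
    by blast+
qed

lemma tensor_bilinear_extension:
  assumes \<phi>1: "\<And>a b. \<lbrakk>a \<in> carrier A; b \<in> carrier B\<rbrakk> \<Longrightarrow> bilinear_map K A B T (\<phi> a b)"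
    and \<phi>2: "\<And>a' b'. \<lbrakk>a' \<in> carrier A; b' \<in> carrier B\<rbrakk> \<Longrightarrow>
      bilinear_map K A B T (\<lambda>a b. \<phi> a b a' b')"
  shows "bilinear_map K T T T (tensor_bilinear K A B \<phi>)"
    and "\<lbrakk>a \<in> carrier A; b \<in> carrier B; a' \<in> carrier A; b' \<in> carrier B\<rbrakk> \<Longrightarrow>
      tensor_bilinear K A B \<phi> (p a b) (p a' b') = \<phi> a b a' b'"
proof -
  define r where "r a b = tensor_linear K A B (\<phi> a b)" for a b
  have r: "linear_map K T T (r a b)" if "a \<in> carrier A" "b \<in> carrier B" for a b
    using that by (simp add: r_def tensor_linear_extension \<phi>1)
  have r_pure: "r a b (p a' b') = \<phi> a b a' b'"
    if "a \<in> carrier A" "b \<in> carrier B" "a' \<in> carrier A" "b' \<in> carrier B" for a b a' b'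
    using that by (simp add: r_def tensor_linear_extension \<phi>1)
  note r' = linear_mapD[OF r]
  have lin_add: "linear_map K T T (\<lambda>Y. f Y \<oplus>\<^bsub>T\<^esub> g Y)"
    if "linear_map K T T f" "linear_map K T T g" for f g
    using linear_mapD[OF that(1)] linear_mapD[OF that(2)]
    by (simp add: linear_map_def T.smult_r_distr T.M.a_ac)
  have lin_smult: "linear_map K T T (\<lambda>Y. k \<odot>\<^bsub>T\<^esub> f Y)"
    if "linear_map K T T f" "k \<in> carrier K" for k f
    using linear_mapD[OF that(1)] that(2)
    by (simp add: linear_map_def T.smult_r_distr T.smult_assoc1[symmetric] A.R.m_comm)
  have r2: "bilinear_map K A B T (\<lambda>a b. r a b Y)" if Y: "Y \<in> carrier T" for Y
  proof (rule bilinear_mapI)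
    fix a b assume a: "a \<in> carrier A" and b: "b \<in> carrier B"
    note ab = r[OF a b]
    show "r a b Y \<in> carrier T" using r' a b Y by blast
    show "r (a \<oplus>\<^bsub>A\<^esub> a') b Y = r a b Y \<oplus>\<^bsub>T\<^esub> r a' b Y" if a': "a' \<in> carrier A" for a'
      by (rule tensor_linear_unique[OF T.module_axioms, where X = Y])
        (use a a' b Y in \<open>simp_all add: r lin_add r_pure bilinear_mapD(2)[OF \<phi>2]\<close>)
    show "r a (b \<oplus>\<^bsub>B\<^esub> b') Y = r a b Y \<oplus>\<^bsub>T\<^esub> r a b' Y" if b': "b' \<in> carrier B" for b'
      by (rule tensor_linear_unique[OF T.module_axioms, where X = Y])
        (use a b b' Y in \<open>simp_all add: r lin_add r_pure bilinear_mapD(3)[OF \<phi>2]\<close>)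
    fix k assume k: "k \<in> carrier K"
    show "r (k \<odot>\<^bsub>A\<^esub> a) b Y = k \<odot>\<^bsub>T\<^esub> r a b Y"
      by (rule tensor_linear_unique[OF T.module_axioms, where X = Y])
        (use k a b Y in \<open>simp_all add: r lin_smult r_pure bilinear_mapD(4)[OF \<phi>2]\<close>)
    show "r a (k \<odot>\<^bsub>B\<^esub> b) Y = k \<odot>\<^bsub>T\<^esub> r a b Y"
      by (rule tensor_linear_unique[OF T.module_axioms, where X = Y])
        (use k a b Y in \<open>simp_all add: r lin_smult r_pure bilinear_mapD(5)[OF \<phi>2]\<close>)
  qed
  define m where "m X Y = (if X \<in> carrier T \<and> Y \<in> carrier T
    then tensor_linear K A B (\<lambda>a b. r a b Y) X else undefined)" for X Y
  have m1: "linear_map K T T (\<lambda>X. m X Y)" if "Y \<in> carrier T" for Y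
    using that tensor_linear_extension(1)[OF r2[OF that]] by (simp add: linear_map_def m_def Pi_iff)
  have m_pure: "m (p a b) Y = r a b Y"
    if "a \<in> carrier A" "b \<in> carrier B" "Y \<in> carrier T" for a b Y
    using that by (simp add: m_def pure_tensor_closed tensor_linear_extension(2) r2)
  note m1' = linear_mapD[OF m1]
  have m2: "linear_map K T T (m X)" if X: "X \<in> carrier T" for X
    unfolding linear_map_def
  proof (intro conjI ballI funcsetI)
    fix Y assume Y: "Y \<in> carrier T"
    show "m X Y \<in> carrier T" using m1' X Y by blast
    show "m X (k \<odot>\<^bsub>T\<^esub> Y) = k \<odot>\<^bsub>T\<^esub> m X Y" if k: "k \<in> carrier K" for k
      by (rule tensor_linear_unique[OF T.module_axioms, where X = X])
        (use k Y X in \<open>simp_all add: m1 lin_smult m_pure r'\<close>)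
    show "m X (Y \<oplus>\<^bsub>T\<^esub> Z) = m X Y \<oplus>\<^bsub>T\<^esub> m X Z" if Z: "Z \<in> carrier T" for Z
      by (rule tensor_linear_unique[OF T.module_axioms, where X = X])
        (use Z Y X in \<open>simp_all add: m1 lin_add m_pure r'\<close>)
  qed
  have "bilinear_map K T T T (tensor_bilinear K A B \<phi>) \<and>
      (\<forall>a\<in>carrier A. \<forall>b\<in>carrier B. \<forall>a'\<in>carrier A. \<forall>b'\<in>carrier B.
        tensor_bilinear K A B \<phi> (p a b) (p a' b') = \<phi> a b a' b') \<and>
      (\<forall>X Y. X \<notin> carrier T \<or> Y \<notin> carrier T \<longrightarrow> tensor_bilinear K A B \<phi> X Y = undefined)"
    (is "?P (tensor_bilinear K A B \<phi>)") unfolding tensor_bilinear_def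
  proof (rule theI[where P = ?P])
    show m: "bilinear_map K T T T m \<and>
        (\<forall>a\<in>carrier A. \<forall>b\<in>carrier B. \<forall>a'\<in>carrier A. \<forall>b'\<in>carrier B.
          m (p a b) (p a' b') = \<phi> a b a' b') \<and>
        (\<forall>X Y. X \<notin> carrier T \<or> Y \<notin> carrier T \<longrightarrow> m X Y = undefined)"
      using m1 m2 by (auto simp: bilinear_map_def m_pure r_pure pure_tensor_closed) (simp_all add: m_def)
    fix n assume n: "bilinear_map K T T T n \<and>
        (\<forall>a\<in>carrier A. \<forall>b\<in>carrier B. \<forall>a'\<in>carrier A. \<forall>b'\<in>carrier B.
          n (p a b) (p a' b') = \<phi> a b a' b') \<and>
        (\<forall>X Y. X \<notin> carrier T \<or> Y \<notin> carrier T \<longrightarrow> n X Y = undefined)"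
    have n2: "linear_map K T T (n X)" if "X \<in> carrier T" for X
      using n that by (simp add: bilinear_map_def)
    have n1: "linear_map K T T (\<lambda>X. n X Y)" if "Y \<in> carrier T" for Y
      using n that by (simp add: bilinear_map_def)
    have "n (p a b) Y = m (p a b) Y" if "a \<in> carrier A" "b \<in> carrier B" "Y \<in> carrier T" for a b Y
      by (rule tensor_linear_unique[OF T.module_axioms n2 m2, where X = Y])
        (use that n m in \<open>simp_all add: pure_tensor_closed\<close>)
    then have "n X Y = m X Y" if "X \<in> carrier T" "Y \<in> carrier T" for X Y
      by (intro tensor_linear_unique[OF T.module_axioms n1 m1, where X = X])
        (use that in simp_all)
    then show "n = m" using m n by (intro ext) metis
  qed
  then show "bilinear_map K T T T (tensor_bilinear K A B \<phi>)"
    and "\<lbrakk>a \<in> carrier A; b \<in> carrier B; a' \<in> carrier A; b' \<in> carrier B\<rbrakk> \<Longrightarrow>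
      tensor_bilinear K A B \<phi> (p a b) (p a' b') = \<phi> a b a' b'"
    by blast+
qed

lemma tensor_map_pure:
  assumes f: "linear_map K A A f" and g: "linear_map K B B g"
  shows "linear_map K T T (tensor_map K A B f g)"
    and "\<lbrakk>a \<in> carrier A; b \<in> carrier B\<rbrakk> \<Longrightarrow> tensor_map K A B f g (p a b) = p (f a) (g b)"
proof -
  note l = linear_mapD[OF f] linear_mapD[OF g]
  have "bilinear_map K A B T (\<lambda>a b. p (f a) (g b))"
    by (rule bilinear_mapI) (simp_all add: l bilinear_mapD[OF bilinear_pure_tensor])
  from tensor_linear_extension[OF this]
  show "linear_map K T T (tensor_map K A B f g)"
    and "\<lbrakk>a \<in> carrier A; b \<in> carrier B\<rbrakk> \<Longrightarrow> tensor_map K A B f g (p a b) = p (f a) (g b)"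
    by (simp_all add: tensor_map_def)
qed

lemma tensor_dot_pure:
  assumes f: "bilinear_map K A A A f" and g: "bilinear_map K B B B g"
  shows "bilinear_map K T T T (tensor_dot K A B f g)"
    and "\<lbrakk>a \<in> carrier A; b \<in> carrier B; a' \<in> carrier A; b' \<in> carrier B\<rbrakk> \<Longrightarrow>
      tensor_dot K A B f g (p a b) (p a' b') = p (f a a') (g b b')"
proof -
  note l = bilinear_mapD[OF f] bilinear_mapD[OF g]
  have "bilinear_map K A B T (\<lambda>a' b'. p (f a a') (g b b'))"
    if "a \<in> carrier A" "b \<in> carrier B" for a b
    by (rule bilinear_mapI) (use that in \<open>simp_all add: l bilinear_mapD[OF bilinear_pure_tensor]\<close>)
  moreover have "bilinear_map K A B T (\<lambda>a b. p (f a a') (g b b'))"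
    if "a' \<in> carrier A" "b' \<in> carrier B" for a' b'
    by (rule bilinear_mapI) (use that in \<open>simp_all add: l bilinear_mapD[OF bilinear_pure_tensor]\<close>)
  ultimately show "bilinear_map K T T T (tensor_dot K A B f g)"
    and "\<lbrakk>a \<in> carrier A; b \<in> carrier B; a' \<in> carrier A; b' \<in> carrier B\<rbrakk> \<Longrightarrow>
      tensor_dot K A B f g (p a b) (p a' b') = p (f a a') (g b b')"
    by (simp_all add: tensor_dot_def tensor_bilinear_extension)
qed

lemma tensor_brk_pure:
  assumes f: "bilinear_map K A A A f" "bilinear_map K A A A f'"
    and g: "bilinear_map K B B B g" "bilinear_map K B B B g'"
  shows "bilinear_map K T T T (tensor_brk K A B f f' g g')"
    and "\<lbrakk>a \<in> carrier A; b \<in> carrier B; a' \<in> carrier A; b' \<in> carrier B\<rbrakk> \<Longrightarrow>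
      tensor_brk K A B f f' g g' (p a b) (p a' b') =
        p (f' a a') (g b b') \<oplus>\<^bsub>T\<^esub> p (f a a') (g' b b')"
proof -
  note l = bilinear_mapD[OF f(1)] bilinear_mapD[OF f(2)] bilinear_mapD[OF g(1)]
    bilinear_mapD[OF g(2)] bilinear_mapD[OF bilinear_pure_tensor] T.M.a_ac T.smult_r_distr
  have "bilinear_map K A B T (\<lambda>a' b'. p (f' a a') (g b b') \<oplus>\<^bsub>T\<^esub> p (f a a') (g' b b'))"
    if "a \<in> carrier A" "b \<in> carrier B" for a b
    by (rule bilinear_mapI) (use that in \<open>simp_all add: l\<close>)
  moreover have "bilinear_map K A B T (\<lambda>a b. p (f' a a') (g b b') \<oplus>\<^bsub>T\<^esub> p (f a a') (g' b b'))"
    if "a' \<in> carrier A" "b' \<in> carrier B" for a' b'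
    by (rule bilinear_mapI) (use that in \<open>simp_all add: l\<close>)
  ultimately show "bilinear_map K T T T (tensor_brk K A B f f' g g')"
    and "\<lbrakk>a \<in> carrier A; b \<in> carrier B; a' \<in> carrier A; b' \<in> carrier B\<rbrakk> \<Longrightarrow>
      tensor_brk K A B f f' g g' (p a b) (p a' b') =
        p (f' a a') (g b b') \<oplus>\<^bsub>T\<^esub> p (f a a') (g' b b')"
    by (simp_all add: tensor_brk_def tensor_bilinear_extension)
qed

end

end

theory Submission
  imports Defs
begin

text \<open>
  The structure maps of a regular algebra can be removed. Writing the product as
  \<open>x \<cdot> y = \<alpha> x * \<beta> y\<close> and the bracket as \<open>[x, y] = {\<alpha> x, \<beta> y}\<close>, which is possible because
  \<open>\<alpha>\<close> and \<open>\<beta>\<close> are bijective, turns each BiHom axiom into the same axiom for \<open>*\<close> and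
  \<open>{,}\<close> with both structure maps equal to the identity (\<open>transposed_poisson_algebra_untwist\<close>):
  \<open>*\<close> is commutative and associative, \<open>{,}\<close> is a Lie bracket and
  \<open>2 x * {y, z} = {x * y, z} + {y, x * z}\<close>. Conversely, two commuting endomorphisms of such an
  ordinary transposed Poisson algebra twist it to a transposed BiHom-Poisson algebra
  (\<open>transposed_bihom_poisson_algebra_twist\<close>). Since the tensor product of the twisted operations
  is the twist of the tensor product by \<open>\<alpha>\<^sub>A \<otimes> \<alpha>\<^sub>B\<close> and \<open>\<beta>\<^sub>A \<otimes> \<beta>\<^sub>B\<close>, it remains to treat ordinary
  transposed Poisson algebras (\<open>transposed_poisson_algebra_tensor\<close>).

  All axioms on \<open>A \<otimes> B\<close> are equations between multilinear maps, so pure tensors suffice. There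
  every axiom but the Jacobi identity follows at once from its counterparts in the factors.
  Expanding the Jacobi sum of \<open>a\<^sub>i \<otimes> b\<^sub>i\<close> gives a Jacobi sum of the \<open>a\<^sub>i\<close> tensored with
  \<open>b\<^sub>1 * b\<^sub>2 * b\<^sub>3\<close>, the same with the factors exchanged, and the cross terms
  \<open>{a\<^sub>1, a\<^sub>2} * a\<^sub>3 \<otimes> {b\<^sub>1 * b\<^sub>2, b\<^sub>3} + {a\<^sub>1 * a\<^sub>2, a\<^sub>3} \<otimes> {b\<^sub>1, b\<^sub>2} * b\<^sub>3\<close>, summed cyclically.
  With \<open>u\<^sub>3 = {a\<^sub>1, a\<^sub>2} * a\<^sub>3\<close> and \<open>w\<^sub>3 = {a\<^sub>1 * a\<^sub>2, a\<^sub>3}\<close>, and cyclically for the other indices,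
  the transposed Leibniz rule says \<open>2 u\<^sub>3 = w\<^sub>2 - w\<^sub>1\<close>. Hence twice the sum of the cross terms is a
  combination of tensors of the \<open>w\<close>'s of \<open>A\<close> with those of \<open>B\<close>, each occurring once with each sign
  (\<open>cross_terms_cancel\<close>), and 2 is invertible in \<open>K\<close>.
\<close>


section \<open>Transposed Poisson algebras\<close>

lemma add_pow_two: "abelian_monoid V \<Longrightarrow> x \<in> carrier V \<Longrightarrow> [(2::nat)] \<cdot>\<^bsub>V\<^esub> x = x \<oplus>\<^bsub>V\<^esub> x"
proof -
  assume "abelian_monoid V" and x: "x \<in> carrier V"
  then interpret abelian_monoid V by simp
  show ?thesis using x by (simp add: numeral_2_eq_2)
qed

text \<open>With identity structure maps the BiHom axioms are those of an ordinary transposed Poisson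
  algebra.\<close>

locale transposed_poisson_algebra = transposed_bihom_poisson_algebra K V dot brk id id
  for K :: "('k, 'm) ring_scheme" (structure)
    and V :: "('k, 'a, 'ma) module_scheme" (structure)
    and dot :: "'a \<Rightarrow> 'a \<Rightarrow> 'a" and brk :: "'a \<Rightarrow> 'a \<Rightarrow> 'a"
begin

lemmas dot = bilinear_mapD[OF commutative.prd_bilinear]

lemmas brk = bilinear_mapD[OF lie.prd_bilinear]

lemma assoc: "\<lbrakk>x \<in> carrier V; y \<in> carrier V; z \<in> carrier V\<rbrakk> \<Longrightarrow> dot (dot x y) z = dot x (dot y z)"
  using commutative.bihom_assoc by simp

lemma comm: "\<lbrakk>x \<in> carrier V; y \<in> carrier V\<rbrakk> \<Longrightarrow> dot x y = dot y x"
  using commutative.bihom_comm[of x y] by simp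

lemma skew: "\<lbrakk>x \<in> carrier V; y \<in> carrier V\<rbrakk> \<Longrightarrow> brk x y = \<ominus>\<^bsub>V\<^esub> brk y x"
  using lie.bihom_skew[of x y] by simp

lemma jacobi:
  "\<lbrakk>x \<in> carrier V; y \<in> carrier V; z \<in> carrier V\<rbrakk> \<Longrightarrow>
    brk (brk x y) z \<oplus>\<^bsub>V\<^esub> brk (brk y z) x \<oplus>\<^bsub>V\<^esub> brk (brk z x) y = \<zero>\<^bsub>V\<^esub>"
  using lie.bihom_jacobi by simp

lemma leibniz:
  "\<lbrakk>x \<in> carrier V; y \<in> carrier V; z \<in> carrier V\<rbrakk> \<Longrightarrow>
    dot x (brk y z) \<oplus>\<^bsub>V\<^esub> dot x (brk y z) = brk (dot x y) z \<oplus>\<^bsub>V\<^esub> brk y (dot x z)"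
  using transposed_leibniz[of x y z] dot(1) brk(1) by (simp add: numeral_2_eq_2)

text \<open>With \<open>x, y, z\<close> for \<open>a\<^sub>1, a\<^sub>2, a\<^sub>3\<close> this is the relation \<open>2 u\<^sub>3 = w\<^sub>2 - w\<^sub>1\<close> that makes the
  cross terms of the Jacobi sum on a tensor product cancel: apply the transposed
  Leibniz rule to \<open>2 z * {x, y}\<close> and turn one bracket around. Keeping \<open>w\<^sub>1\<close> on the left avoids
  inverses in the cancellation.\<close>

lemma double_product_bracket:
  assumes "x \<in> carrier V" "y \<in> carrier V" "z \<in> carrier V"
  shows "dot (brk x y) z \<oplus>\<^bsub>V\<^esub> dot (brk x y) z \<oplus>\<^bsub>V\<^esub> brk (dot y z) x = brk (dot z x) y"
proof -
  have "brk x (dot z y) = \<ominus>\<^bsub>V\<^esub> brk (dot y z) x"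
    using assms dot(1) skew[of x "dot z y"] by (simp add: comm[of z y])
  then have "brk x (dot z y) \<oplus>\<^bsub>V\<^esub> brk (dot y z) x = \<zero>\<^bsub>V\<^esub>"
    using assms dot(1) brk(1) by (simp add: commutative.M.l_neg)
  moreover have "dot (brk x y) z \<oplus>\<^bsub>V\<^esub> dot (brk x y) z = brk (dot z x) y \<oplus>\<^bsub>V\<^esub> brk x (dot z y)"
    using assms brk(1) leibniz[of z x y] by (simp only: comm[of "brk x y" z])
  moreover have "brk (dot z x) y \<in> carrier V" "brk x (dot z y) \<in> carrier V" "brk (dot y z) x \<in> carrier V"
    using assms dot(1) brk(1) by simp_all
  ultimately show ?thesis
    by (simp only: commutative.M.a_assoc commutative.M.r_zero)
qed

end

lemma transposed_poisson_algebraI: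
  assumes "field K" "module K V"
    and dot: "bilinear_map K V V V dot" and brk: "bilinear_map K V V V brk"
    and assoc: "\<And>x y z. \<lbrakk>x \<in> carrier V; y \<in> carrier V; z \<in> carrier V\<rbrakk> \<Longrightarrow>
      dot (dot x y) z = dot x (dot y z)"
    and comm: "\<And>x y. \<lbrakk>x \<in> carrier V; y \<in> carrier V\<rbrakk> \<Longrightarrow> dot x y = dot y x"
    and skew: "\<And>x y. \<lbrakk>x \<in> carrier V; y \<in> carrier V\<rbrakk> \<Longrightarrow> brk x y = \<ominus>\<^bsub>V\<^esub> brk y x"
    and jacobi: "\<And>x y z. \<lbrakk>x \<in> carrier V; y \<in> carrier V; z \<in> carrier V\<rbrakk> \<Longrightarrow>
      brk (brk x y) z \<oplus>\<^bsub>V\<^esub> brk (brk y z) x \<oplus>\<^bsub>V\<^esub> brk (brk z x) y = \<zero>\<^bsub>V\<^esub>"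
    and leibniz: "\<And>x y z. \<lbrakk>x \<in> carrier V; y \<in> carrier V; z \<in> carrier V\<rbrakk> \<Longrightarrow>
      dot x (brk y z) \<oplus>\<^bsub>V\<^esub> dot x (brk y z) = brk (dot x y) z \<oplus>\<^bsub>V\<^esub> brk y (dot x z)"
  shows "transposed_poisson_algebra K V dot brk"
proof -
  interpret K: field K by fact
  interpret V: module K V by fact
  have id: "linear_map K V V id" by (simp add: linear_map_def)
  show ?thesis
  proof unfold_locales
    show "brk (id x) (id y) = \<ominus>\<^bsub>V\<^esub> brk (id y) (id x)"
      if "x \<in> carrier V" "y \<in> carrier V" for x y
      using skew[OF that] by simp
    show "dot (id x) (dot y z) = dot (dot x y) (id z)"
      if "x \<in> carrier V" "y \<in> carrier V" "z \<in> carrier V" for x y z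
      using assoc[OF that] by simp
  qed (use id dot brk bilinear_mapD(1)[OF dot] bilinear_mapD(1)[OF brk] in
      \<open>simp_all add: jacobi leibniz add_pow_two V.M.abelian_monoid_axioms comm\<close>)
qed


section \<open>Twisting and untwisting\<close>

text \<open>Pulling \<open>\<alpha>\<close> and \<open>\<beta>\<close> inside all operations gives every variable the same twist in each
  term of an axiom, for instance \<open>\<alpha>\<^sup>2 x\<close>, \<open>\<alpha> \<beta> y\<close> and \<open>\<beta>\<^sup>2 z\<close> in associativity; what
  remains is the untwisted axiom at these elements. The twisted operations are only described on
  the carrier because the tensor product operations are undefined outside it.\<close>

lemma transposed_bihom_poisson_algebra_twist:
  assumes "transposed_poisson_algebra K V star brc"
    and dot: "bilinear_map K V V V dot" and brk: "bilinear_map K V V V brk"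
    and \<alpha>: "linear_map K V V \<alpha>" and \<beta>: "linear_map K V V \<beta>"
    and comm: "\<And>x. x \<in> carrier V \<Longrightarrow> \<alpha> (\<beta> x) = \<beta> (\<alpha> x)"
    and star: "\<And>x y. \<lbrakk>x \<in> carrier V; y \<in> carrier V\<rbrakk> \<Longrightarrow> \<alpha> (star x y) = star (\<alpha> x) (\<alpha> y)"
      "\<And>x y. \<lbrakk>x \<in> carrier V; y \<in> carrier V\<rbrakk> \<Longrightarrow> \<beta> (star x y) = star (\<beta> x) (\<beta> y)"
    and brc: "\<And>x y. \<lbrakk>x \<in> carrier V; y \<in> carrier V\<rbrakk> \<Longrightarrow> \<alpha> (brc x y) = brc (\<alpha> x) (\<alpha> y)"
      "\<And>x y. \<lbrakk>x \<in> carrier V; y \<in> carrier V\<rbrakk> \<Longrightarrow> \<beta> (brc x y) = brc (\<beta> x) (\<beta> y)"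
    and dot_eq: "\<And>x y. \<lbrakk>x \<in> carrier V; y \<in> carrier V\<rbrakk> \<Longrightarrow> dot x y = star (\<alpha> x) (\<beta> y)"
    and brk_eq: "\<And>x y. \<lbrakk>x \<in> carrier V; y \<in> carrier V\<rbrakk> \<Longrightarrow> brk x y = brc (\<alpha> x) (\<beta> y)"
  shows "transposed_bihom_poisson_algebra K V dot brk \<alpha> \<beta>"
proof -
  interpret P: transposed_poisson_algebra K V star brc by fact
  note simps = linear_mapD(1)[OF \<alpha>] linear_mapD(1)[OF \<beta>] P.dot(1) P.brk(1)
    comm star brc dot_eq brk_eq
  show ?thesis
  proof unfold_locales
    fix x y z assume x: "x \<in> carrier V" and y: "y \<in> carrier V" and z: "z \<in> carrier V"
    show "dot (\<alpha> x) (dot y z) = dot (dot x y) (\<beta> z)"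
      using x y z by (simp add: simps P.assoc)
    show "brk (brk (\<beta> x) (\<alpha> y)) (\<alpha> (\<alpha> z)) \<oplus>\<^bsub>V\<^esub> brk (brk (\<beta> y) (\<alpha> z)) (\<alpha> (\<alpha> x)) \<oplus>\<^bsub>V\<^esub>
        brk (brk (\<beta> z) (\<alpha> x)) (\<alpha> (\<alpha> y)) = \<zero>\<^bsub>V\<^esub>"
      using x y z by (simp add: simps P.jacobi)
    show "[(2::nat)] \<cdot>\<^bsub>V\<^esub> dot (\<alpha> (\<beta> x)) (brk y z) =
        brk (dot (\<beta> x) y) (\<beta> z) \<oplus>\<^bsub>V\<^esub> brk (\<beta> y) (dot (\<alpha> x) z)"
      using x y z
      by (simp add: simps add_pow_two P.commutative.M.abelian_monoid_axioms P.leibniz)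
  next
    fix x y assume x: "x \<in> carrier V" and y: "y \<in> carrier V"
    show "dot (\<beta> x) (\<alpha> y) = dot (\<beta> y) (\<alpha> x)"
      using x y P.comm[of "\<beta> (\<alpha> x)" "\<beta> (\<alpha> y)"] by (simp add: simps)
    show "brk (\<beta> x) (\<alpha> y) = \<ominus>\<^bsub>V\<^esub> brk (\<beta> y) (\<alpha> x)"
      using x y P.skew[of "\<beta> (\<alpha> x)" "\<beta> (\<alpha> y)"] by (simp add: simps)
  qed (use \<alpha> \<beta> dot brk in \<open>simp_all add: simps\<close>)
qed

lemma linear_map_inv_into:
  assumes "module K V" and f: "linear_map K V V f" and bij: "bij_betw f (carrier V) (carrier V)"
  shows "linear_map K V V (inv_into (carrier V) f)"
proof -
  interpret V: module K V by fact
  let ?g = "inv_into (carrier V) f"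
  have g: "?g y \<in> carrier V" "f (?g y) = y" if "y \<in> carrier V" for y
    using that bij by (simp_all add: bij_betw_def inv_into_into f_inv_into_f)
  have inv: "?g y = x" if "x \<in> carrier V" "f x = y" for x y
    using that bij by (auto simp: bij_betw_def)
  show ?thesis
    unfolding linear_map_def by (auto simp: g linear_mapD[OF f] intro!: inv)
qed

definition untwist ::
  "('k, 'a, 'ma) module_scheme \<Rightarrow> ('a \<Rightarrow> 'a) \<Rightarrow> ('a \<Rightarrow> 'a) \<Rightarrow> ('a \<Rightarrow> 'a \<Rightarrow> 'a) \<Rightarrow> 'a \<Rightarrow> 'a \<Rightarrow> 'a"
  where "untwist V \<alpha> \<beta> m = (\<lambda>x y. m (inv_into (carrier V) \<alpha> x) (inv_into (carrier V) \<beta> y))"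

context regular_transposed_bihom_poisson_algebra
begin

lemmas maps_closed = linear_mapD(1)[OF commutative.\<alpha>_linear] linear_mapD(1)[OF commutative.\<beta>_linear]

lemma untwist_bilinear:
  assumes m: "bilinear_map K V V V m"
  shows "bilinear_map K V V V (untwist V \<alpha> \<beta> m)"
proof -
  note inv = linear_mapD[OF linear_map_inv_into[OF commutative.module_axioms commutative.\<alpha>_linear \<alpha>_bij]]
    linear_mapD[OF linear_map_inv_into[OF commutative.module_axioms commutative.\<beta>_linear \<beta>_bij]]
  show ?thesis
    by (rule bilinear_mapI) (simp_all add: untwist_def inv bilinear_mapD[OF m])
qed

lemma untwist_twisted:
  "\<lbrakk>x \<in> carrier V; y \<in> carrier V\<rbrakk> \<Longrightarrow> untwist V \<alpha> \<beta> m (\<alpha> x) (\<beta> y) = m x y"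
  using \<alpha>_bij \<beta>_bij by (simp add: untwist_def bij_betw_def)

lemma \<alpha>_surj: "x \<in> carrier V \<Longrightarrow> \<exists>u\<in>carrier V. x = \<alpha> u"
  using \<alpha>_bij by (auto simp: bij_betw_def)

lemma \<beta>_surj: "x \<in> carrier V \<Longrightarrow> \<exists>u\<in>carrier V. x = \<beta> u"
  using \<beta>_bij by (auto simp: bij_betw_def)

lemma untwist_multiplicative:
  assumes \<gamma>: "\<And>x. x \<in> carrier V \<Longrightarrow> \<gamma> x \<in> carrier V"
      "\<And>x. x \<in> carrier V \<Longrightarrow> \<gamma> (\<alpha> x) = \<alpha> (\<gamma> x)" "\<And>x. x \<in> carrier V \<Longrightarrow> \<gamma> (\<beta> x) = \<beta> (\<gamma> x)"
      "\<And>x y. \<lbrakk>x \<in> carrier V; y \<in> carrier V\<rbrakk> \<Longrightarrow> \<gamma> (m x y) = m (\<gamma> x) (\<gamma> y)"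
    and x: "x \<in> carrier V" and y: "y \<in> carrier V"
  shows "\<gamma> (untwist V \<alpha> \<beta> m x y) = untwist V \<alpha> \<beta> m (\<gamma> x) (\<gamma> y)"
proof -
  obtain u v where "u \<in> carrier V" "x = \<alpha> u" "v \<in> carrier V" "y = \<beta> v"
    using \<alpha>_surj[OF x] \<beta>_surj[OF y] by blast
  then show ?thesis by (simp add: untwist_twisted \<gamma>)
qed

lemma maps_untwist:
  assumes "x \<in> carrier V" "y \<in> carrier V"
  shows "\<alpha> (untwist V \<alpha> \<beta> dot x y) = untwist V \<alpha> \<beta> dot (\<alpha> x) (\<alpha> y)"
    and "\<beta> (untwist V \<alpha> \<beta> dot x y) = untwist V \<alpha> \<beta> dot (\<beta> x) (\<beta> y)"
    and "\<alpha> (untwist V \<alpha> \<beta> brk x y) = untwist V \<alpha> \<beta> brk (\<alpha> x) (\<alpha> y)"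
    and "\<beta> (untwist V \<alpha> \<beta> brk x y) = untwist V \<alpha> \<beta> brk (\<beta> x) (\<beta> y)"
  by (rule untwist_multiplicative;
      simp add: assms maps_closed commutative.\<alpha>_\<beta>_commute commutative.\<alpha>_prd commutative.\<beta>_prd
        lie.\<alpha>_prd lie.\<beta>_prd)+

text \<open>By surjectivity the elements in an ordinary axiom can be taken to be twisted in exactly the way
  in which the corresponding BiHom axiom twists its variables: \<open>\<alpha>\<^sup>2 u\<close>, \<open>\<alpha> \<beta> v\<close>, \<open>\<beta>\<^sup>2 w\<close> for
  associativity, \<open>\<alpha>\<^sup>2 \<beta> u\<close>, \<open>\<alpha> \<beta> v\<close>, \<open>\<beta>\<^sup>2 w\<close> for the transposed Leibniz rule, \<open>\<alpha> \<beta>\<close> of each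
  variable for commutativity and skew symmetry, and \<open>\<alpha>\<^sup>2 \<beta>\<close> of each for the Jacobi identity.
  Then \<open>untwist_twisted\<close> reduces both sides to the BiHom axiom.\<close>

lemma transposed_poisson_algebra_untwist:
  "transposed_poisson_algebra K V (untwist V \<alpha> \<beta> dot) (untwist V \<alpha> \<beta> brk)"
proof (rule transposed_poisson_algebraI)
  let ?s = "untwist V \<alpha> \<beta> dot" and ?b = "untwist V \<alpha> \<beta> brk"
  note closed = bilinear_mapD(1)[OF commutative.prd_bilinear] bilinear_mapD(1)[OF lie.prd_bilinear]
  show "?s (?s x y) z = ?s x (?s y z)"
    if x: "x \<in> carrier V" and y: "y \<in> carrier V" and z: "z \<in> carrier V" for x y z
  proof -
    obtain u where u: "u \<in> carrier V" "x = \<alpha> (\<alpha> u)" using x by (metis \<alpha>_surj)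
    obtain v where v: "v \<in> carrier V" "y = \<alpha> (\<beta> v)" using y by (metis \<alpha>_surj \<beta>_surj)
    obtain w where w: "w \<in> carrier V" "z = \<beta> (\<beta> w)" using z by (metis \<beta>_surj)
    have "?s x y = \<alpha> (dot u v)" using u v untwist_twisted[of "\<alpha> u" "\<alpha> v" dot]
      by (simp add: maps_closed commutative.\<alpha>_\<beta>_commute commutative.\<alpha>_prd)
    moreover have "?s y z = \<beta> (dot v w)" using v w untwist_twisted[of "\<beta> v" "\<beta> w" dot]
      by (simp add: maps_closed commutative.\<beta>_prd)
    ultimately show ?thesis
      using u v w by (simp add: maps_closed closed untwist_twisted commutative.bihom_assoc)
  qed
  show "?s x y = ?s y x" if x: "x \<in> carrier V" and y: "y \<in> carrier V" for x y
  proof -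
    obtain u where u: "u \<in> carrier V" "x = \<alpha> (\<beta> u)" using x by (metis \<alpha>_surj \<beta>_surj)
    obtain v where v: "v \<in> carrier V" "y = \<alpha> (\<beta> v)" using y by (metis \<alpha>_surj \<beta>_surj)
    show ?thesis
      using u v untwist_twisted[of "\<beta> u" "\<alpha> v" dot] untwist_twisted[of "\<beta> v" "\<alpha> u" dot]
      by (simp add: maps_closed commutative.\<alpha>_\<beta>_commute commutative.bihom_comm)
  qed
  show "?b x y = \<ominus>\<^bsub>V\<^esub> ?b y x" if x: "x \<in> carrier V" and y: "y \<in> carrier V" for x y
  proof -
    obtain u where u: "u \<in> carrier V" "x = \<alpha> (\<beta> u)" using x by (metis \<alpha>_surj \<beta>_surj)
    obtain v where v: "v \<in> carrier V" "y = \<alpha> (\<beta> v)" using y by (metis \<alpha>_surj \<beta>_surj)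
    show ?thesis
      using u v untwist_twisted[of "\<beta> u" "\<alpha> v" brk] untwist_twisted[of "\<beta> v" "\<alpha> u" brk]
        lie.bihom_skew[of u v]
      by (simp add: maps_closed commutative.\<alpha>_\<beta>_commute)
  qed
  show "?b (?b x y) z \<oplus>\<^bsub>V\<^esub> ?b (?b y z) x \<oplus>\<^bsub>V\<^esub> ?b (?b z x) y = \<zero>\<^bsub>V\<^esub>"
    if x: "x \<in> carrier V" and y: "y \<in> carrier V" and z: "z \<in> carrier V" for x y z
  proof -
    have *: "?b (?b (\<alpha> (\<alpha> (\<beta> u))) (\<alpha> (\<alpha> (\<beta> v)))) (\<alpha> (\<alpha> (\<beta> w))) = brk (brk (\<beta> u) (\<alpha> v)) (\<alpha> (\<alpha> w))"
      if "u \<in> carrier V" "v \<in> carrier V" "w \<in> carrier V" for u v w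
    proof -
      have "?b (\<alpha> (\<alpha> (\<beta> u))) (\<alpha> (\<alpha> (\<beta> v))) = \<alpha> (brk (\<beta> u) (\<alpha> v))"
        using that untwist_twisted[of "\<alpha> (\<beta> u)" "\<alpha> (\<alpha> v)" brk]
        by (simp add: maps_closed commutative.\<alpha>_\<beta>_commute lie.\<alpha>_prd)
      then show ?thesis
        using that untwist_twisted[of "brk (\<beta> u) (\<alpha> v)" "\<alpha> (\<alpha> w)" brk]
        by (simp add: maps_closed closed commutative.\<alpha>_\<beta>_commute)
    qed
    obtain u where u: "u \<in> carrier V" "x = \<alpha> (\<alpha> (\<beta> u))" using x by (metis \<alpha>_surj \<beta>_surj)
    obtain v where v: "v \<in> carrier V" "y = \<alpha> (\<alpha> (\<beta> v))" using y by (metis \<alpha>_surj \<beta>_surj)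
    obtain w where w: "w \<in> carrier V" "z = \<alpha> (\<alpha> (\<beta> w))" using z by (metis \<alpha>_surj \<beta>_surj)
    show ?thesis using u v w by (simp add: * lie.bihom_jacobi)
  qed
  show "?s x (?b y z) \<oplus>\<^bsub>V\<^esub> ?s x (?b y z) = ?b (?s x y) z \<oplus>\<^bsub>V\<^esub> ?b y (?s x z)"
    if x: "x \<in> carrier V" and y: "y \<in> carrier V" and z: "z \<in> carrier V" for x y z
  proof -
    obtain u where u: "u \<in> carrier V" "x = \<alpha> (\<alpha> (\<beta> u))" using x by (metis \<alpha>_surj \<beta>_surj)
    obtain v where v: "v \<in> carrier V" "y = \<alpha> (\<beta> v)" using y by (metis \<alpha>_surj \<beta>_surj)
    obtain w where w: "w \<in> carrier V" "z = \<beta> (\<beta> w)" using z by (metis \<beta>_surj)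
    have "?b y z = \<beta> (brk v w)" using v w untwist_twisted[of "\<beta> v" "\<beta> w" brk]
      by (simp add: maps_closed lie.\<beta>_prd)
    then have 1: "?s x (?b y z) = dot (\<alpha> (\<beta> u)) (brk v w)"
      using u v w by (simp add: maps_closed closed untwist_twisted)
    have "?s x y = \<alpha> (dot (\<beta> u) v)" using u v untwist_twisted[of "\<alpha> (\<beta> u)" "\<alpha> v" dot]
      by (simp add: maps_closed commutative.\<alpha>_\<beta>_commute commutative.\<alpha>_prd)
    then have 2: "?b (?s x y) z = brk (dot (\<beta> u) v) (\<beta> w)"
      using u v w by (simp add: maps_closed closed untwist_twisted)
    have "?s x z = \<beta> (dot (\<alpha> u) w)" using u w untwist_twisted[of "\<alpha> (\<beta> u)" "\<beta> w" dot]
      by (simp add: maps_closed commutative.\<alpha>_\<beta>_commute commutative.\<beta>_prd)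
    then have 3: "?b y (?s x z) = brk (\<beta> v) (dot (\<alpha> u) w)"
      using u v w by (simp add: maps_closed closed untwist_twisted)
    show ?thesis
      unfolding 1 2 3 using transposed_leibniz[of u v w] u v w
      by (simp add: add_pow_two commutative.M.abelian_monoid_axioms closed maps_closed)
  qed
qed (use commutative.field_axioms commutative.module_axioms untwist_bilinear
    commutative.prd_bilinear lie.prd_bilinear in auto)

end


section \<open>Multilinear maps on a tensor product\<close>

lemma tensor_bilinear_unique:
  assumes "module K A" "module K B" "module K W"
    and f: "bilinear_map K (tensor_product K A B) (tensor_product K A B) W f"
    and g: "bilinear_map K (tensor_product K A B) (tensor_product K A B) W g"
    and pure: "\<And>a b a' b'. \<lbrakk>a \<in> carrier A; b \<in> carrier B; a' \<in> carrier A; b' \<in> carrier B\<rbrakk> \<Longrightarrow>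
      f (pure_tensor K A B a b) (pure_tensor K A B a' b') =
      g (pure_tensor K A B a b) (pure_tensor K A B a' b')"
    and X: "X \<in> carrier (tensor_product K A B)" and Y: "Y \<in> carrier (tensor_product K A B)"
  shows "f X Y = g X Y"
proof -
  note unique = tensor_linear_unique[OF assms(1-3)]
  note closed = pure_tensor_closed[OF assms(1,2)]
  have on_pure: "f (pure_tensor K A B a b) Y = g (pure_tensor K A B a b) Y"
    if "a \<in> carrier A" "b \<in> carrier B" for a b
    by (rule unique[of "f (pure_tensor K A B a b)" "g (pure_tensor K A B a b)"])
      (use that f g closed Y in \<open>simp_all add: bilinear_map_def pure\<close>)
  show ?thesis
    by (rule unique[of "\<lambda>X. f X Y" "\<lambda>X. g X Y", OF _ _ _ X])
      (use f g Y in \<open>simp_all add: on_pure bilinear_map_def\<close>)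
qed

definition trilinear_map ::
  "('k, 'm) ring_scheme \<Rightarrow> ('k, 'a, 'ma) module_scheme \<Rightarrow> ('k, 'b, 'mb) module_scheme
    \<Rightarrow> ('a \<Rightarrow> 'a \<Rightarrow> 'a \<Rightarrow> 'b) \<Rightarrow> bool"
  where "trilinear_map K V W f \<longleftrightarrow>
    (\<forall>y\<in>carrier V. \<forall>z\<in>carrier V. linear_map K V W (\<lambda>x. f x y z)) \<and>
    (\<forall>x\<in>carrier V. bilinear_map K V V W (f x))"

lemma tensor_trilinear_unique:
  assumes "module K A" "module K B" "module K W"
    and f: "trilinear_map K (tensor_product K A B) W f"
    and g: "trilinear_map K (tensor_product K A B) W g"
    and pure: "\<And>a b a' b' a'' b''. \<lbrakk>a \<in> carrier A; b \<in> carrier B; a' \<in> carrier A; b' \<in> carrier B;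
        a'' \<in> carrier A; b'' \<in> carrier B\<rbrakk> \<Longrightarrow>
      f (pure_tensor K A B a b) (pure_tensor K A B a' b') (pure_tensor K A B a'' b'') =
      g (pure_tensor K A B a b) (pure_tensor K A B a' b') (pure_tensor K A B a'' b'')"
    and X: "X \<in> carrier (tensor_product K A B)" and Y: "Y \<in> carrier (tensor_product K A B)"
    and Z: "Z \<in> carrier (tensor_product K A B)"
  shows "f X Y Z = g X Y Z"
proof -
  note closed = pure_tensor_closed[OF assms(1,2)]
  have on_pure: "f (pure_tensor K A B a b) Y Z = g (pure_tensor K A B a b) Y Z"
    if "a \<in> carrier A" "b \<in> carrier B" for a b
    by (rule tensor_bilinear_unique[OF assms(1-3),
          of "f (pure_tensor K A B a b)" "g (pure_tensor K A B a b)"])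
      (use that f g closed Y Z in \<open>simp_all add: trilinear_map_def pure\<close>)
  show ?thesis
    by (rule tensor_linear_unique[OF assms(1-3), of "\<lambda>X. f X Y Z" "\<lambda>X. g X Y Z", OF _ _ _ X])
      (use f g Y Z in \<open>simp_all add: on_pure trilinear_map_def\<close>)
qed

context
  fixes K :: "('k, 'm) ring_scheme" and V :: "('k, 'a, 'ma) module_scheme" and W :: "('k, 'b, 'mb) module_scheme"
  assumes V: "module K V" and W: "module K W"
begin

interpretation V: module K V by (rule V)
interpretation W: module K W by (rule W)

lemma trilinear_map_add:
  assumes "trilinear_map K V W f" "trilinear_map K V W g"
  shows "trilinear_map K V W (\<lambda>x y z. f x y z \<oplus>\<^bsub>W\<^esub> g x y z)"
  using assms
  by (auto simp: trilinear_map_def bilinear_map_def linear_map_def W.smult_r_distr W.M.a_ac Pi_iff)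

lemma trilinear_map_zero: "trilinear_map K V W (\<lambda>x y z. \<zero>\<^bsub>W\<^esub>)"
  by (simp add: trilinear_map_def bilinear_map_def linear_map_def)

end

text \<open>These are the shapes of the terms in the associative, Jacobi and transposed Leibniz laws.\<close>

lemma trilinear_map_compose:
  assumes "bilinear_map K V V V m" "bilinear_map K V V W n"
  shows "trilinear_map K V W (\<lambda>x y z. n (m x y) z)" "trilinear_map K V W (\<lambda>x y z. n (m y z) x)"
    "trilinear_map K V W (\<lambda>x y z. n (m z x) y)"
    "trilinear_map K V W (\<lambda>x y z. n x (m y z))" "trilinear_map K V W (\<lambda>x y z. n y (m x z))"
  using assms by (simp_all add: trilinear_map_def bilinear_map_def linear_map_def Pi_iff)

lemma bilinear_map_twist:
  assumes "bilinear_map K V V W m" "linear_map K V V f" "linear_map K V V g"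
  shows "bilinear_map K V V W (\<lambda>x y. m (f x) (g y))"
  using linear_mapD[OF assms(2)] linear_mapD[OF assms(3)]
  by (intro bilinear_mapI) (simp_all add: bilinear_mapD[OF assms(1)])

lemma bilinear_map_compose:
  assumes "bilinear_map K V V U m" "linear_map K U W h"
  shows "bilinear_map K V V W (\<lambda>x y. h (m x y))"
  using linear_mapD[OF assms(2)]
  by (intro bilinear_mapI) (simp_all add: bilinear_mapD[OF assms(1)])


section \<open>Tensor products of transposed Poisson algebras\<close>

lemma double_eq_zero:
  assumes "field K" "module K W" and two: "[(2::nat)] \<cdot>\<^bsub>K\<^esub> \<one>\<^bsub>K\<^esub> \<noteq> \<zero>\<^bsub>K\<^esub>"
    and x: "x \<in> carrier W" and "x \<oplus>\<^bsub>W\<^esub> x = \<zero>\<^bsub>W\<^esub>"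
  shows "x = \<zero>\<^bsub>W\<^esub>"
proof -
  interpret K: field K by fact
  interpret W: module K W by fact
  let ?t = "\<one>\<^bsub>K\<^esub> \<oplus>\<^bsub>K\<^esub> \<one>\<^bsub>K\<^esub>"
  have t: "?t \<in> Units K" using two by (simp add: add_pow_two K.abelian_monoid_axioms K.field_Units)
  have "?t \<odot>\<^bsub>W\<^esub> x = \<zero>\<^bsub>W\<^esub>" using assms(5) x by (simp add: W.smult_l_distr)
  then have "(inv\<^bsub>K\<^esub> ?t \<otimes>\<^bsub>K\<^esub> ?t) \<odot>\<^bsub>W\<^esub> x = \<zero>\<^bsub>W\<^esub>"
    using t x by (simp only: W.smult_assoc1 K.Units_inv_closed K.Units_closed W.smult_r_null)
  then show ?thesis using t x by (simp add: K.Units_l_inv)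
qed

text \<open>In \<open>2 u\<^sub>i \<otimes> s\<^sub>i\<close> and \<open>w\<^sub>i \<otimes> 2 v\<^sub>i\<close> the doubled elements are differences of \<open>w\<close>'s and of
  \<open>s\<close>'s, so twice the sum is a combination of the \<open>w\<^sub>i \<otimes> s\<^sub>j\<close> with \<open>i \<noteq> j\<close>. Every such tensor
  occurs once with each sign, because both families of differences have the same cyclic pattern.\<close>

lemma cross_terms_cancel:
  assumes "field K" "module K A" "module K B" "module K W"
    and two: "[(2::nat)] \<cdot>\<^bsub>K\<^esub> \<one>\<^bsub>K\<^esub> \<noteq> \<zero>\<^bsub>K\<^esub>" and p: "bilinear_map K A B W p"
    and u: "u1 \<in> carrier A" "u2 \<in> carrier A" "u3 \<in> carrier A"
    and w: "w1 \<in> carrier A" "w2 \<in> carrier A" "w3 \<in> carrier A"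
    and v: "v1 \<in> carrier B" "v2 \<in> carrier B" "v3 \<in> carrier B"
    and s: "s1 \<in> carrier B" "s2 \<in> carrier B" "s3 \<in> carrier B"
    and uw: "u1 \<oplus>\<^bsub>A\<^esub> u1 \<oplus>\<^bsub>A\<^esub> w2 = w3" "u2 \<oplus>\<^bsub>A\<^esub> u2 \<oplus>\<^bsub>A\<^esub> w3 = w1" "u3 \<oplus>\<^bsub>A\<^esub> u3 \<oplus>\<^bsub>A\<^esub> w1 = w2"
    and vs: "v1 \<oplus>\<^bsub>B\<^esub> v1 \<oplus>\<^bsub>B\<^esub> s2 = s3" "v2 \<oplus>\<^bsub>B\<^esub> v2 \<oplus>\<^bsub>B\<^esub> s3 = s1" "v3 \<oplus>\<^bsub>B\<^esub> v3 \<oplus>\<^bsub>B\<^esub> s1 = s2"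
  shows "(p u1 s1 \<oplus>\<^bsub>W\<^esub> p w1 v1) \<oplus>\<^bsub>W\<^esub> (p u2 s2 \<oplus>\<^bsub>W\<^esub> p w2 v2) \<oplus>\<^bsub>W\<^esub> (p u3 s3 \<oplus>\<^bsub>W\<^esub> p w3 v3) = \<zero>\<^bsub>W\<^esub>"
    (is "?x = _")
proof (rule double_eq_zero[OF assms(1,4) two])
  interpret A: module K A by fact
  interpret B: module K B by fact
  interpret W: module K W by fact
  note p = bilinear_mapD[OF p]
  \<comment> \<open>The negative parts of all differences; they are also the positive parts, in another order.\<close>
  let ?r = "(p w2 s1 \<oplus>\<^bsub>W\<^esub> p w1 s2) \<oplus>\<^bsub>W\<^esub> (p w3 s2 \<oplus>\<^bsub>W\<^esub> p w2 s3) \<oplus>\<^bsub>W\<^esub> (p w1 s3 \<oplus>\<^bsub>W\<^esub> p w3 s1)"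
  show x: "?x \<in> carrier W" using u v w s by (simp add: p)
  have r: "?r \<in> carrier W" using w s by (simp add: p)
  have "(?x \<oplus>\<^bsub>W\<^esub> ?x) \<oplus>\<^bsub>W\<^esub> ?r =
      (p (u1 \<oplus>\<^bsub>A\<^esub> u1 \<oplus>\<^bsub>A\<^esub> w2) s1 \<oplus>\<^bsub>W\<^esub> p w1 (v1 \<oplus>\<^bsub>B\<^esub> v1 \<oplus>\<^bsub>B\<^esub> s2)) \<oplus>\<^bsub>W\<^esub>
      (p (u2 \<oplus>\<^bsub>A\<^esub> u2 \<oplus>\<^bsub>A\<^esub> w3) s2 \<oplus>\<^bsub>W\<^esub> p w2 (v2 \<oplus>\<^bsub>B\<^esub> v2 \<oplus>\<^bsub>B\<^esub> s3)) \<oplus>\<^bsub>W\<^esub>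
      (p (u3 \<oplus>\<^bsub>A\<^esub> u3 \<oplus>\<^bsub>A\<^esub> w1) s3 \<oplus>\<^bsub>W\<^esub> p w3 (v3 \<oplus>\<^bsub>B\<^esub> v3 \<oplus>\<^bsub>B\<^esub> s1))"
    using u v w s by (simp add: p W.M.a_ac)
  also have "\<dots> = \<zero>\<^bsub>W\<^esub> \<oplus>\<^bsub>W\<^esub> ?r"
    unfolding uw vs using w s by (simp add: p W.M.a_ac)
  finally show "?x \<oplus>\<^bsub>W\<^esub> ?x = \<zero>\<^bsub>W\<^esub>"
    using x r W.M.add.right_cancel[of ?r "?x \<oplus>\<^bsub>W\<^esub> ?x" "\<zero>\<^bsub>W\<^esub>"]
    by (simp only: W.M.a_closed W.M.zero_closed)
qed

text \<open>Each axiom is checked on pure tensors. In the Jacobi identity the commutative associative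
  factors of the three cyclic terms coincide, which isolates the Jacobi sums of \<open>A\<close> and \<open>B\<close> from
  the cross terms.\<close>

lemma transposed_poisson_algebra_tensor:
  assumes "transposed_poisson_algebra K A dotA brkA" and "transposed_poisson_algebra K B dotB brkB"
    and two: "[(2::nat)] \<cdot>\<^bsub>K\<^esub> \<one>\<^bsub>K\<^esub> \<noteq> \<zero>\<^bsub>K\<^esub>"
  shows "transposed_poisson_algebra K (tensor_product K A B)
    (tensor_dot K A B dotA dotB) (tensor_brk K A B dotA brkA dotB brkB)"
proof -
  interpret A: transposed_poisson_algebra K A dotA brkA by fact
  interpret B: transposed_poisson_algebra K B dotB brkB by fact
  note AB = A.commutative.module_axioms B.commutative.module_axioms
  let ?T = "tensor_product K A B" and ?p = "pure_tensor K A B"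
  let ?dot = "tensor_dot K A B dotA dotB" and ?brk = "tensor_brk K A B dotA brkA dotB brkB"
  interpret T: module K ?T by (rule module_tensor_product[OF AB])
  note dot_pure = tensor_dot_pure[OF AB A.commutative.prd_bilinear B.commutative.prd_bilinear]
  note brk_pure = tensor_brk_pure[OF AB A.commutative.prd_bilinear A.lie.prd_bilinear
      B.commutative.prd_bilinear B.lie.prd_bilinear]
  note dot = bilinear_mapD[OF dot_pure(1)] and brk = bilinear_mapD[OF brk_pure(1)]
  note p = bilinear_mapD[OF bilinear_pure_tensor[OF AB]]
  note closed = A.dot(1) A.brk(1) B.dot(1) B.brk(1)
  note eval = dot_pure(2) brk_pure(2) dot(2,3) brk(2,3) p(1) closed
  have p_minus: "?p (\<ominus>\<^bsub>A\<^esub> a) b = \<ominus>\<^bsub>?T\<^esub> ?p a b" "?p a (\<ominus>\<^bsub>B\<^esub> b) = \<ominus>\<^bsub>?T\<^esub> ?p a b"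
    if "a \<in> carrier A" "b \<in> carrier B" for a b
    using that bilinear_pure_tensor[OF AB] linear_map_zero_minus(2)[OF AB(1) T.module_axioms]
      linear_map_zero_minus(2)[OF AB(2) T.module_axioms]
    unfolding bilinear_map_def by blast+
  have p_zero: "?p \<zero>\<^bsub>A\<^esub> b = \<zero>\<^bsub>?T\<^esub>" "?p a \<zero>\<^bsub>B\<^esub> = \<zero>\<^bsub>?T\<^esub>"
    if "a \<in> carrier A" "b \<in> carrier B" for a b
    using that bilinear_pure_tensor[OF AB] linear_map_zero_minus(1)[OF AB(1) T.module_axioms]
      linear_map_zero_minus(1)[OF AB(2) T.module_axioms]
    unfolding bilinear_map_def by blast+
  note tri = trilinear_map_compose trilinear_map_add[OF T.module_axioms T.module_axioms]
    trilinear_map_zero[OF T.module_axioms T.module_axioms] dot_pure(1) brk_pure(1)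
  note unique2 = tensor_bilinear_unique[OF AB T.module_axioms]
  note unique3 = tensor_trilinear_unique[OF AB T.module_axioms]
  show ?thesis
  proof (rule transposed_poisson_algebraI[OF A.commutative.field_axioms T.module_axioms dot_pure(1) brk_pure(1)])
    fix X Y assume X: "X \<in> carrier ?T" and Y: "Y \<in> carrier ?T"
    have swap: "bilinear_map K ?T ?T ?T (\<lambda>X Y. m Y X)" if "bilinear_map K ?T ?T ?T m" for m
      using that by (simp add: bilinear_map_def)
    show "?dot X Y = ?dot Y X"
      by (rule unique2[where g = "\<lambda>X Y. ?dot Y X", OF _ _ _ X Y])
        (use dot_pure(1) swap in \<open>simp_all add: eval A.comm B.comm\<close>)
    have neg: "bilinear_map K ?T ?T ?T (\<lambda>X Y. \<ominus>\<^bsub>?T\<^esub> ?brk Y X)"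
      by (rule bilinear_mapI) (simp_all add: brk T.M.minus_add T.smult_r_minus)
    show "?brk X Y = \<ominus>\<^bsub>?T\<^esub> ?brk Y X"
    proof (rule unique2[where g = "\<lambda>X Y. \<ominus>\<^bsub>?T\<^esub> ?brk Y X", OF brk_pure(1) neg _ X Y])
      fix a b a' b'
      assume *: "a \<in> carrier A" "b \<in> carrier B" "a' \<in> carrier A" "b' \<in> carrier B"
      show "?brk (?p a b) (?p a' b') = \<ominus>\<^bsub>?T\<^esub> ?brk (?p a' b') (?p a b)"
        using * A.skew[of a a'] B.skew[of b b'] A.comm[of a a'] B.comm[of b b']
        by (simp add: eval p_minus T.M.minus_add)
    qed
    fix Z assume Z: "Z \<in> carrier ?T"
    show "?dot (?dot X Y) Z = ?dot X (?dot Y Z)"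
      by (rule unique3[where f = "\<lambda>X Y Z. ?dot (?dot X Y) Z" and g = "\<lambda>X Y Z. ?dot X (?dot Y Z)",
            OF _ _ _ X Y Z])
        (use tri in \<open>simp_all add: eval A.assoc B.assoc\<close>)
    show "?dot X (?brk Y Z) \<oplus>\<^bsub>?T\<^esub> ?dot X (?brk Y Z) = ?brk (?dot X Y) Z \<oplus>\<^bsub>?T\<^esub> ?brk Y (?dot X Z)"
    proof (rule unique3[where f = "\<lambda>X Y Z. ?dot X (?brk Y Z) \<oplus>\<^bsub>?T\<^esub> ?dot X (?brk Y Z)"
          and g = "\<lambda>X Y Z. ?brk (?dot X Y) Z \<oplus>\<^bsub>?T\<^esub> ?brk Y (?dot X Z)", OF _ _ _ X Y Z])
      fix a b a' b' a'' b''
      assume *: "a \<in> carrier A" "b \<in> carrier B" "a' \<in> carrier A" "b' \<in> carrier B"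
        "a'' \<in> carrier A" "b'' \<in> carrier B"
      let ?a = "dotA a (dotA a' a'')" and ?b = "dotB b (dotB b' b'')"
      have "?dot (?p a b) (?brk (?p a' b') (?p a'' b'')) \<oplus>\<^bsub>?T\<^esub> ?dot (?p a b) (?brk (?p a' b') (?p a'' b'')) =
          ?p (dotA a (brkA a' a'') \<oplus>\<^bsub>A\<^esub> dotA a (brkA a' a'')) ?b \<oplus>\<^bsub>?T\<^esub>
          ?p ?a (dotB b (brkB b' b'') \<oplus>\<^bsub>B\<^esub> dotB b (brkB b' b''))"
        using * by (simp add: eval p T.M.a_ac)
      also have "\<dots> = ?p (brkA (dotA a a') a'' \<oplus>\<^bsub>A\<^esub> brkA a' (dotA a a'')) ?b \<oplus>\<^bsub>?T\<^esub>
          ?p ?a (brkB (dotB b b') b'' \<oplus>\<^bsub>B\<^esub> brkB b' (dotB b b''))"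
        using * by (simp add: A.leibniz B.leibniz)
      also have "\<dots> = ?brk (?dot (?p a b) (?p a' b')) (?p a'' b'') \<oplus>\<^bsub>?T\<^esub>
          ?brk (?p a' b') (?dot (?p a b) (?p a'' b''))"
      proof -
        have "dotA a' (dotA a a'') = ?a" "dotB b' (dotB b b'') = ?b"
          "dotA (dotA a a') a'' = ?a" "dotB (dotB b b') b'' = ?b"
          using * A.comm[of a a'] B.comm[of b b'] by (simp_all flip: A.assoc B.assoc)
        then show ?thesis using * by (simp add: eval p T.M.a_ac)
      qed
      finally show "?dot (?p a b) (?brk (?p a' b') (?p a'' b'')) \<oplus>\<^bsub>?T\<^esub>
          ?dot (?p a b) (?brk (?p a' b') (?p a'' b'')) =
          ?brk (?dot (?p a b) (?p a' b')) (?p a'' b'') \<oplus>\<^bsub>?T\<^esub>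
          ?brk (?p a' b') (?dot (?p a b) (?p a'' b''))" .
    qed (intro tri)+
    show "?brk (?brk X Y) Z \<oplus>\<^bsub>?T\<^esub> ?brk (?brk Y Z) X \<oplus>\<^bsub>?T\<^esub> ?brk (?brk Z X) Y = \<zero>\<^bsub>?T\<^esub>"
    proof (rule unique3[where f = "\<lambda>X Y Z. ?brk (?brk X Y) Z \<oplus>\<^bsub>?T\<^esub> ?brk (?brk Y Z) X \<oplus>\<^bsub>?T\<^esub> ?brk (?brk Z X) Y"
          and g = "\<lambda>X Y Z. \<zero>\<^bsub>?T\<^esub>", OF _ _ _ X Y Z])
      fix a1 b1 a2 b2 a3 b3
      assume *: "a1 \<in> carrier A" "b1 \<in> carrier B" "a2 \<in> carrier A" "b2 \<in> carrier B"
        "a3 \<in> carrier A" "b3 \<in> carrier B"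
      let ?a = "dotA (dotA a1 a2) a3" and ?b = "dotB (dotB b1 b2) b3"
      \<comment> \<open>The cross terms of one iterated bracket.\<close>
      let ?c = "\<lambda>a b a' b' a'' b''. ?p (dotA (brkA a a') a'') (brkB (dotB b b') b'') \<oplus>\<^bsub>?T\<^esub>
        ?p (brkA (dotA a a') a'') (dotB (brkB b b') b'')"
      have abc: "dotA (dotA a2 a3) a1 = ?a" "dotB (dotB b2 b3) b1 = ?b"
          "dotA (dotA a3 a1) a2 = ?a" "dotB (dotB b3 b1) b2 = ?b"
        using * A.dot(1) B.dot(1)
          A.comm[of a1 "dotA a2 a3"] B.comm[of b1 "dotB b2 b3"] A.comm[of "dotA a1 a2" a3] B.comm[of "dotB b1 b2" b3]
        by (simp_all add: A.assoc B.assoc)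
      have expand: "?brk (?brk (?p a b) (?p a' b')) (?p a'' b'') =
          ?p (brkA (brkA a a') a'') (dotB (dotB b b') b'') \<oplus>\<^bsub>?T\<^esub> ?c a b a' b' a'' b'' \<oplus>\<^bsub>?T\<^esub>
          ?p (dotA (dotA a a') a'') (brkB (brkB b b') b'')"
        if "a \<in> carrier A" "b \<in> carrier B" "a' \<in> carrier A" "b' \<in> carrier B"
          "a'' \<in> carrier A" "b'' \<in> carrier B" for a b a' b' a'' b''
        using that by (simp add: eval T.M.a_ac)
      have cross: "?c a2 b2 a3 b3 a1 b1 \<oplus>\<^bsub>?T\<^esub> ?c a3 b3 a1 b1 a2 b2 \<oplus>\<^bsub>?T\<^esub> ?c a1 b1 a2 b2 a3 b3 = \<zero>\<^bsub>?T\<^esub>"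
        using * by (intro cross_terms_cancel[OF A.commutative.field_axioms AB T.module_axioms two
              bilinear_pure_tensor[OF AB]] closed A.double_product_bracket B.double_product_bracket)
      have "?brk (?brk (?p a1 b1) (?p a2 b2)) (?p a3 b3) \<oplus>\<^bsub>?T\<^esub>
          ?brk (?brk (?p a2 b2) (?p a3 b3)) (?p a1 b1) \<oplus>\<^bsub>?T\<^esub>
          ?brk (?brk (?p a3 b3) (?p a1 b1)) (?p a2 b2) =
          ?p (brkA (brkA a1 a2) a3 \<oplus>\<^bsub>A\<^esub> brkA (brkA a2 a3) a1 \<oplus>\<^bsub>A\<^esub> brkA (brkA a3 a1) a2) ?b \<oplus>\<^bsub>?T\<^esub>
          (?c a2 b2 a3 b3 a1 b1 \<oplus>\<^bsub>?T\<^esub> ?c a3 b3 a1 b1 a2 b2 \<oplus>\<^bsub>?T\<^esub> ?c a1 b1 a2 b2 a3 b3) \<oplus>\<^bsub>?T\<^esub>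
          ?p ?a (brkB (brkB b1 b2) b3 \<oplus>\<^bsub>B\<^esub> brkB (brkB b2 b3) b1 \<oplus>\<^bsub>B\<^esub> brkB (brkB b3 b1) b2)"
        using * by (simp add: expand abc p closed T.M.a_ac)
      also have "\<dots> = \<zero>\<^bsub>?T\<^esub>"
        unfolding cross using * by (simp add: A.jacobi B.jacobi p_zero closed)
      finally show "?brk (?brk (?p a1 b1) (?p a2 b2)) (?p a3 b3) \<oplus>\<^bsub>?T\<^esub>
          ?brk (?brk (?p a2 b2) (?p a3 b3)) (?p a1 b1) \<oplus>\<^bsub>?T\<^esub>
          ?brk (?brk (?p a3 b3) (?p a1 b1)) (?p a2 b2) = \<zero>\<^bsub>?T\<^esub>" .
    qed (intro tri)+
  qed
qed


section \<open>Tensor products of regular transposed BiHom-Poisson algebras\<close>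

theorem theorem2p11:
  fixes K :: "('k, 'm) ring_scheme"
    and A :: "('k, 'a, 'ma) module_scheme" and B :: "('k, 'b, 'mb) module_scheme"
    and dotA brkA :: "'a \<Rightarrow> 'a \<Rightarrow> 'a" and \<alpha>A \<beta>A :: "'a \<Rightarrow> 'a"
    and dotB brkB :: "'b \<Rightarrow> 'b \<Rightarrow> 'b" and \<alpha>B \<beta>B :: "'b \<Rightarrow> 'b"
  assumes "field K"
    and char_0: "\<And>n::nat. n > 0 \<Longrightarrow> [n] \<cdot>\<^bsub>K\<^esub> \<one>\<^bsub>K\<^esub> \<noteq> \<zero>\<^bsub>K\<^esub>"
    and "regular_transposed_bihom_poisson_algebra K A dotA brkA \<alpha>A \<beta>A"
    and "regular_transposed_bihom_poisson_algebra K B dotB brkB \<alpha>B \<beta>B"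
  shows "transposed_bihom_poisson_algebra K (tensor_product K A B)
    (tensor_dot K A B dotA dotB) (tensor_brk K A B dotA brkA dotB brkB)
    (tensor_map K A B \<alpha>A \<alpha>B) (tensor_map K A B \<beta>A \<beta>B)"
proof -
  interpret A: regular_transposed_bihom_poisson_algebra K A dotA brkA \<alpha>A \<beta>A by fact
  interpret B: regular_transposed_bihom_poisson_algebra K B dotB brkB \<alpha>B \<beta>B by fact
  let ?T = "tensor_product K A B" and ?p = "pure_tensor K A B"
  let ?\<alpha> = "tensor_map K A B \<alpha>A \<alpha>B" and ?\<beta> = "tensor_map K A B \<beta>A \<beta>B"
  define starA starB where "starA = untwist A \<alpha>A \<beta>A dotA" and "starB = untwist B \<alpha>B \<beta>B dotB"
  define brcA brcB where "brcA = untwist A \<alpha>A \<beta>A brkA" and "brcB = untwist B \<alpha>B \<beta>B brkB"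
  note defs = starA_def starB_def brcA_def brcB_def
  let ?star = "tensor_dot K A B starA starB" and ?brc = "tensor_brk K A B starA brcA starB brcB"
  have PA: "transposed_poisson_algebra K A starA brcA"
    unfolding defs by (rule A.transposed_poisson_algebra_untwist)
  have PB: "transposed_poisson_algebra K B starB brcB"
    unfolding defs by (rule B.transposed_poisson_algebra_untwist)
  interpret PA: transposed_poisson_algebra K A starA brcA by (rule PA)
  interpret PB: transposed_poisson_algebra K B starB brcB by (rule PB)
  note AB = A.commutative.module_axioms B.commutative.module_axioms
  interpret T: module K ?T by (rule module_tensor_product[OF AB])
  note \<alpha> = tensor_map_pure[OF AB A.commutative.\<alpha>_linear B.commutative.\<alpha>_linear]
    and \<beta> = tensor_map_pure[OF AB A.commutative.\<beta>_linear B.commutative.\<beta>_linear]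
  note dot = tensor_dot_pure[OF AB A.commutative.prd_bilinear B.commutative.prd_bilinear]
    and brk = tensor_brk_pure[OF AB A.commutative.prd_bilinear A.lie.prd_bilinear
      B.commutative.prd_bilinear B.lie.prd_bilinear]
  note star = tensor_dot_pure[OF AB PA.commutative.prd_bilinear PB.commutative.prd_bilinear]
    and brc = tensor_brk_pure[OF AB PA.commutative.prd_bilinear PA.lie.prd_bilinear
      PB.commutative.prd_bilinear PB.lie.prd_bilinear]
  note p = bilinear_mapD(1)[OF bilinear_pure_tensor[OF AB]]
  note closed = A.maps_closed B.maps_closed PA.dot(1) PA.brk(1) PB.dot(1) PB.brk(1)
  have twisted: "starA (\<alpha>A a) (\<beta>A a') = dotA a a'" "brcA (\<alpha>A a) (\<beta>A a') = brkA a a'"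
    if "a \<in> carrier A" "a' \<in> carrier A" for a a'
    using that by (simp_all add: defs A.untwist_twisted)
  have twisted': "starB (\<alpha>B b) (\<beta>B b') = dotB b b'" "brcB (\<alpha>B b) (\<beta>B b') = brkB b b'"
    if "b \<in> carrier B" "b' \<in> carrier B" for b b'
    using that by (simp_all add: defs B.untwist_twisted)
  have mult: "\<alpha>A (starA a a') = starA (\<alpha>A a) (\<alpha>A a')" "\<beta>A (starA a a') = starA (\<beta>A a) (\<beta>A a')"
    "\<alpha>A (brcA a a') = brcA (\<alpha>A a) (\<alpha>A a')" "\<beta>A (brcA a a') = brcA (\<beta>A a) (\<beta>A a')"
    if "a \<in> carrier A" "a' \<in> carrier A" for a a'
    using that unfolding defs
    by (simp_all add: A.maps_untwist)
  have mult': "\<alpha>B (starB b b') = starB (\<alpha>B b) (\<alpha>B b')" "\<beta>B (starB b b') = starB (\<beta>B b) (\<beta>B b')"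
    "\<alpha>B (brcB b b') = brcB (\<alpha>B b) (\<alpha>B b')" "\<beta>B (brcB b b') = brcB (\<beta>B b) (\<beta>B b')"
    if "b \<in> carrier B" "b' \<in> carrier B" for b b'
    using that unfolding defs
    by (simp_all add: B.maps_untwist)
  have multiplicative: "h (m X Y) = m (h X) (h Y)"
    if "bilinear_map K ?T ?T ?T m" "linear_map K ?T ?T h" "X \<in> carrier ?T" "Y \<in> carrier ?T"
      "\<And>a b a' b'. \<lbrakk>a \<in> carrier A; b \<in> carrier B; a' \<in> carrier A; b' \<in> carrier B\<rbrakk> \<Longrightarrow>
        h (m (?p a b) (?p a' b')) = m (h (?p a b)) (h (?p a' b'))" for h m X Y
    by (rule tensor_bilinear_unique[OF AB T.module_axioms,
          where f = "\<lambda>X Y. h (m X Y)" and g = "\<lambda>X Y. m (h X) (h Y)"])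
      (use that in \<open>simp_all add: bilinear_map_compose bilinear_map_twist\<close>)
  note eval = \<alpha>(2) \<beta>(2) dot(2) brk(2) star(2) brc(2) p closed twisted twisted' mult mult'
    linear_mapD(2)[OF \<alpha>(1)] linear_mapD(2)[OF \<beta>(1)]
  show ?thesis
  proof (rule transposed_bihom_poisson_algebra_twist)
    show "transposed_poisson_algebra K ?T ?star ?brc"
      using PA PB char_0[of 2] by (intro transposed_poisson_algebra_tensor) simp_all
    fix X assume X: "X \<in> carrier ?T"
    show "?\<alpha> (?\<beta> X) = ?\<beta> (?\<alpha> X)"
      by (rule tensor_linear_unique[OF AB T.module_axioms,
            where f = "\<lambda>X. ?\<alpha> (?\<beta> X)" and g = "\<lambda>X. ?\<beta> (?\<alpha> X)", OF _ _ _ X])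
        (use linear_mapD[OF \<alpha>(1)] linear_mapD[OF \<beta>(1)] in
          \<open>simp_all add: linear_map_def eval A.commutative.\<alpha>_\<beta>_commute B.commutative.\<alpha>_\<beta>_commute\<close>)
    fix Y assume Y: "Y \<in> carrier ?T"
    show "?\<alpha> (?star X Y) = ?star (?\<alpha> X) (?\<alpha> Y)"
      by (rule multiplicative[OF star(1) \<alpha>(1) X Y]) (simp add: eval)
    show "?\<beta> (?star X Y) = ?star (?\<beta> X) (?\<beta> Y)"
      by (rule multiplicative[OF star(1) \<beta>(1) X Y]) (simp add: eval)
    show "?\<alpha> (?brc X Y) = ?brc (?\<alpha> X) (?\<alpha> Y)"
      by (rule multiplicative[OF brc(1) \<alpha>(1) X Y]) (simp add: eval)
    show "?\<beta> (?brc X Y) = ?brc (?\<beta> X) (?\<beta> Y)"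
      by (rule multiplicative[OF brc(1) \<beta>(1) X Y]) (simp add: eval)
    show "tensor_dot K A B dotA dotB X Y = ?star (?\<alpha> X) (?\<beta> Y)"
      by (rule tensor_bilinear_unique[OF AB T.module_axioms dot(1)
            bilinear_map_twist[OF star(1) \<alpha>(1) \<beta>(1)] _ X Y]) (simp add: eval)
    show "tensor_brk K A B dotA brkA dotB brkB X Y = ?brc (?\<alpha> X) (?\<beta> Y)"
      by (rule tensor_bilinear_unique[OF AB T.module_axioms brk(1)
            bilinear_map_twist[OF brc(1) \<alpha>(1) \<beta>(1)] _ X Y]) (simp add: eval)
  qed (rule dot(1) brk(1) \<alpha>(1) \<beta>(1))+
qed

end
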